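(* Let $p:X\to(0,\infty)$ be a positive measurable function and let $\mathcal{F}=\{f_x\}_{x\in X}$ be a $p$-weakly localized continuous frame in $\mathcal{H}$. Let $\mathcal{L}$ be the collection of all bounded linear operators on $\mathcal{H}$ that are $p$-weakly localized with respect to $(\tilde{\mathcal{F}},\mathcal{F})$. Then $\mathcal{L}$ forms an algebra (under the usual addition, scalar multiplication and composition of operators). Moreover, if $\mathcal{F}$ is a Parseval continuous frame, then $\mathcal{L}$ is a $*$-algebra (with the Hilbert space adjoint as involution).
   Context: $\mathcal{H}$ is a separable Hilbert space, $(X,d,\lambda)$ a locally compact metric measure space with a Radon measure $\lambda$, $D(x,r)$ the closed ball of radius $r$ about $x$, $D(x,r)^c$ its complement. Continuous frame: a family $\{f_x\}_{x\in X}$ in $\mathcal{H}$ such that $x\mapsto f_x$ is bounded and continuous and there are constants $c,C>0$ with $c\|f\|^2\le\int_X|\langle f,f_x\rangle|^2d\lambda(x)\le C\|f\|^2$ for all $f\in\mathcal{H}$; it is Parseval if $c=C=1$. Canonical dual: $\tilde{\mathcal{F}}=\{\tilde f_x\}$, $\tilde f_x=S^{-1}f_x$, $Sf=\int_X\langle f,f_x\rangle f_x\,d\lambda(x)$ (weak integral). A pair $(\mathcal{K},\mathcal{G})$ of families $\mathcal{K}=\{k_x\}_{x\in X}$, $\mathcal{G}=\{g_x\}_{x\in X}$ in $\mathcal{H}$ is $p$-weakly localized if there is a constant $M$ with $\int_X|\langle k_x,g_y\rangle|p(y)d\lambda(y)\le Mp(x)$ for all $x$ and $\int_X|\langle k_x,g_y\rangle|p(x)d\lambda(x)\le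 Mp(y)$ for all $y$, and $$\lim_{R\to\infty}\sup_{x\in X}\frac1{p(x)}\int_{D(x,R)^c}|\langle k_x,g_y\rangle|p(y)d\lambda(y)=0,\quad \lim_{R\to\infty}\sup_{y\in X}\frac1{p(y)}\int_{D(y,R)^c}|\langle k_x,g_y\rangle|p(x)d\lambda(x)=0.$$ The continuous frame $\mathcal{F}$ is $p$-weakly localized if the pair $(\tilde{\mathcal{F}},\mathcal{F})$ is. An operator $T$ is $p$-weakly localized with respect to $(\tilde{\mathcal{F}},\mathcal{F})$ if the pair $(\{T\tilde f_x\}_{x\in X},\mathcal{F})$ is $p$-weakly localized. *)

theory Defs
  imports "HOL-Analysis.Analysis"
begin

section \<open>Complex Hilbert spaces\<close>

text \<open>
  HOL-Analysis only has real inner product spaces.  The inner product below is linear in the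
  first and conjugate-linear in the second argument.  Its positive definiteness is contained in
  the axiom \<open>norm_eq_sqrt_cinner\<close>, since norms are nonnegative and vanish only at 0.
\<close>

class complex_inner = real_normed_vector +
  fixes scaleC :: "complex \<Rightarrow> 'a \<Rightarrow> 'a" (infixr "*\<^sub>C" 75)
    and cinner :: "'a \<Rightarrow> 'a \<Rightarrow> complex"
  assumes scaleC_add_right: "c *\<^sub>C (x + y) = c *\<^sub>C x + c *\<^sub>C y"
    and scaleC_add_left: "(b + c) *\<^sub>C x = b *\<^sub>C x + c *\<^sub>C x"
    and scaleC_scaleC: "b *\<^sub>C (c *\<^sub>C x) = (b * c) *\<^sub>C x"
    and scaleC_of_real: "complex_of_real r *\<^sub>C x = r *\<^sub>R x"
    and cinner_commute: "cinner x y = cnj (cinner y x)"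
    and cinner_add_left: "cinner (x + y) z = cinner x z + cinner y z"
    and cinner_scaleC_left: "cinner (c *\<^sub>C x) y = c * cinner x y"
    and norm_eq_sqrt_cinner: "norm x = sqrt (Re (cinner x x))"

class complex_hilbert_space = complex_inner + banach

instantiation complex :: complex_hilbert_space
begin

definition scaleC_complex :: "complex \<Rightarrow> complex \<Rightarrow> complex"
  where "scaleC_complex c x = c * x"

definition cinner_complex :: "complex \<Rightarrow> complex \<Rightarrow> complex"
  where "cinner_complex x y = x * cnj y"

instance
  by standard
    (auto simp: scaleC_complex_def cinner_complex_def algebra_simps scaleR_conv_of_real
      cmod_def power2_eq_square)

end

definition bounded_clinear :: "('h::complex_inner \<Rightarrow> 'h) \<Rightarrow> bool"
  where "bounded_clinear T \<longleftrightarrow> bounded_linear T \<and> (\<forall>c x. T (c *\<^sub>C x) = c *\<^sub>C T x)"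

definition cadjoint :: "('h::complex_inner \<Rightarrow> 'h) \<Rightarrow> 'h \<Rightarrow> 'h"
  where "cadjoint T = (THE A. \<forall>x y. cinner (T x) y = cinner x (A y))"

section \<open>Complex algebras and *-algebras on a carrier set\<close>

text \<open>Algebras are associative; a unit is not required.\<close>

locale complex_algebra_on =
  fixes A :: "'a set"
    and add :: "'a \<Rightarrow> 'a \<Rightarrow> 'a"
    and zero :: 'a
    and scale :: "complex \<Rightarrow> 'a \<Rightarrow> 'a"
    and mult :: "'a \<Rightarrow> 'a \<Rightarrow> 'a"
  assumes zero_closed: "zero \<in> A"
    and add_closed: "\<lbrakk>a \<in> A; b \<in> A\<rbrakk> \<Longrightarrow> add a b \<in> A"
    and scale_closed: "a \<in> A \<Longrightarrow> scale s a \<in> A"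
    and mult_closed: "\<lbrakk>a \<in> A; b \<in> A\<rbrakk> \<Longrightarrow> mult a b \<in> A"
    and add_assoc: "\<lbrakk>a \<in> A; b \<in> A; c \<in> A\<rbrakk> \<Longrightarrow> add (add a b) c = add a (add b c)"
    and add_commute: "\<lbrakk>a \<in> A; b \<in> A\<rbrakk> \<Longrightarrow> add a b = add b a"
    and add_zero: "a \<in> A \<Longrightarrow> add a zero = a"
    and add_inverse: "a \<in> A \<Longrightarrow> \<exists>b\<in>A. add a b = zero"
    and scale_add: "\<lbrakk>a \<in> A; b \<in> A\<rbrakk> \<Longrightarrow> scale s (add a b) = add (scale s a) (scale s b)"
    and add_scale: "a \<in> A \<Longrightarrow> scale (s + t) a = add (scale s a) (scale t a)"
    and scale_scale: "a \<in> A \<Longrightarrow> scale s (scale t a) = scale (s * t) a"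
    and scale_one: "a \<in> A \<Longrightarrow> scale 1 a = a"
    and mult_assoc: "\<lbrakk>a \<in> A; b \<in> A; c \<in> A\<rbrakk> \<Longrightarrow> mult (mult a b) c = mult a (mult b c)"
    and mult_add_left: "\<lbrakk>a \<in> A; b \<in> A; c \<in> A\<rbrakk> \<Longrightarrow> mult (add a b) c = add (mult a c) (mult b c)"
    and mult_add_right: "\<lbrakk>a \<in> A; b \<in> A; c \<in> A\<rbrakk> \<Longrightarrow> mult a (add b c) = add (mult a b) (mult a c)"
    and mult_scale_left: "\<lbrakk>a \<in> A; b \<in> A\<rbrakk> \<Longrightarrow> mult (scale s a) b = scale s (mult a b)"
    and mult_scale_right: "\<lbrakk>a \<in> A; b \<in> A\<rbrakk> \<Longrightarrow> mult a (scale s b) = scale s (mult a b)"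

locale complex_star_algebra_on = complex_algebra_on A add zero scale mult
  for A :: "'a set" and add zero scale mult +
  fixes star :: "'a \<Rightarrow> 'a"
  assumes star_closed: "a \<in> A \<Longrightarrow> star a \<in> A"
    and star_star: "a \<in> A \<Longrightarrow> star (star a) = a"
    and star_add: "\<lbrakk>a \<in> A; b \<in> A\<rbrakk> \<Longrightarrow> star (add a b) = add (star a) (star b)"
    and star_scale: "a \<in> A \<Longrightarrow> star (scale s a) = scale (cnj s) (star a)"
    and star_mult: "\<lbrakk>a \<in> A; b \<in> A\<rbrakk> \<Longrightarrow> star (mult a b) = mult (star b) (star a)"

section \<open>Radon measures, weak integrals and continuous frames\<close>

definition radon_measure :: "'x::topological_space measure \<Rightarrow> bool"
  where "radon_measure \<mu> \<longleftrightarrow>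
    sets \<mu> = sets borel \<and>
    (\<forall>K. compact K \<longrightarrow> emeasure \<mu> K < \<infinity>) \<and>
    (\<forall>B\<in>sets borel. emeasure \<mu> B = (INF U\<in>{U. open U \<and> B \<subseteq> U}. emeasure \<mu> U)) \<and>
    (\<forall>U. open U \<longrightarrow> emeasure \<mu> U = (SUP K\<in>{K. compact K \<and> K \<subseteq> U}. emeasure \<mu> K))"

definition has_weak_integral :: "'x measure \<Rightarrow> ('x \<Rightarrow> 'h::complex_inner) \<Rightarrow> 'h \<Rightarrow> bool"
  where "has_weak_integral \<mu> F h \<longleftrightarrow>
    (\<forall>g. integrable \<mu> (\<lambda>x. cinner (F x) g) \<and> cinner h g = (\<integral>x. cinner (F x) g \<partial>\<mu>))"

definition weak_integral :: "'x measure \<Rightarrow> ('x \<Rightarrow> 'h::complex_inner) \<Rightarrow> 'h"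
  where "weak_integral \<mu> F = (THE h. has_weak_integral \<mu> F h)"

definition continuous_frame_with_bounds ::
    "'x::metric_space measure \<Rightarrow> real \<Rightarrow> real \<Rightarrow> ('x \<Rightarrow> 'h::complex_inner) \<Rightarrow> bool"
  where "continuous_frame_with_bounds \<mu> c C f \<longleftrightarrow>
    bounded (range f) \<and> continuous_on UNIV f \<and>
    (\<forall>h. ennreal (c * (norm h)\<^sup>2) \<le> (\<integral>\<^sup>+x. ennreal ((cmod (cinner h (f x)))\<^sup>2) \<partial>\<mu>) \<and>
         (\<integral>\<^sup>+x. ennreal ((cmod (cinner h (f x)))\<^sup>2) \<partial>\<mu>) \<le> ennreal (C * (norm h)\<^sup>2))"

definition continuous_frame ::
    "'x::metric_space measure \<Rightarrow> ('x \<Rightarrow> 'h::complex_inner) \<Rightarrow> bool"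
  where "continuous_frame \<mu> f \<longleftrightarrow> (\<exists>c>0. \<exists>C>0. continuous_frame_with_bounds \<mu> c C f)"

definition parseval_frame ::
    "'x::metric_space measure \<Rightarrow> ('x \<Rightarrow> 'h::complex_inner) \<Rightarrow> bool"
  where "parseval_frame \<mu> f \<longleftrightarrow> continuous_frame_with_bounds \<mu> 1 1 f"

definition frame_operator :: "'x measure \<Rightarrow> ('x \<Rightarrow> 'h::complex_inner) \<Rightarrow> 'h \<Rightarrow> 'h"
  where "frame_operator \<mu> f h = weak_integral \<mu> (\<lambda>x. cinner h (f x) *\<^sub>C f x)"

definition canonical_dual :: "'x measure \<Rightarrow> ('x \<Rightarrow> 'h::complex_inner) \<Rightarrow> 'x \<Rightarrow> 'h"
  where "canonical_dual \<mu> f x = inv (frame_operator \<mu> f) (f x)"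

section \<open>Weak localization\<close>

definition weakly_localized_pair ::
    "'x::metric_space measure \<Rightarrow> ('x \<Rightarrow> real) \<Rightarrow> ('x \<Rightarrow> 'h::complex_inner) \<Rightarrow> ('x \<Rightarrow> 'h) \<Rightarrow> bool"
  where "weakly_localized_pair \<mu> p k g \<longleftrightarrow>
    (\<exists>M::real.
       (\<forall>x. (\<integral>\<^sup>+y. ennreal (cmod (cinner (k x) (g y)) * p y) \<partial>\<mu>) \<le> ennreal (M * p x)) \<and>
       (\<forall>y. (\<integral>\<^sup>+x. ennreal (cmod (cinner (k x) (g y)) * p x) \<partial>\<mu>) \<le> ennreal (M * p y))) \<and>
    ((\<lambda>R. SUP x. ennreal (1 / p x) *
        (\<integral>\<^sup>+y\<in>- cball x R. ennreal (cmod (cinner (k x) (g y)) * p y) \<partial>\<mu>)) \<longlongrightarrow> 0) at_top \<and>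
    ((\<lambda>R. SUP y. ennreal (1 / p y) *
        (\<integral>\<^sup>+x\<in>- cball y R. ennreal (cmod (cinner (k x) (g y)) * p x) \<partial>\<mu>)) \<longlongrightarrow> 0) at_top"

definition weakly_localized_frame ::
    "'x::metric_space measure \<Rightarrow> ('x \<Rightarrow> real) \<Rightarrow> ('x \<Rightarrow> 'h::complex_inner) \<Rightarrow> bool"
  where "weakly_localized_frame \<mu> p f \<longleftrightarrow>
    continuous_frame \<mu> f \<and> weakly_localized_pair \<mu> p (canonical_dual \<mu> f) f"

definition weakly_localized_operators ::
    "'x::metric_space measure \<Rightarrow> ('x \<Rightarrow> real) \<Rightarrow> ('x \<Rightarrow> 'h::complex_inner) \<Rightarrow> ('h \<Rightarrow> 'h) set"
  where "weakly_localized_operators \<mu> p f =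
    {T. bounded_clinear T \<and> weakly_localized_pair \<mu> p (\<lambda>x. T (canonical_dual \<mu> f x)) f}"

end

theory Submission
  imports Defs
begin

text \<open>
  Let \<open>R\<close> be the inverse of the frame operator. Since \<open>R\<close> is self-adjoint, every \<open>h\<close> satisfies
  \<open>\<langle>h, g\<rangle> = \<integral> \<langle>h, f z\<rangle> \<langle>R (f z), g\<rangle> d\<mu>(z)\<close>. Hence the kernel of \<open>S \<circ> T\<close> is dominated by the composition of
  the kernels \<open>|\<langle>T (R (f x)), f z\<rangle>|\<close> and \<open>|\<langle>S (R (f z)), f y\<rangle>|\<close>. Tonelli bounds its weighted row integrals, and since
  \<open>d(x, y) > r\<close> forces \<open>d(x, z) > r/2\<close> or \<open>d(z, y) > r/2\<close>, its tails are bounded by the tails of the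
  factors. Tonelli is legitimate because, \<open>\<H>\<close> being separable, the set where \<open>f\<close> does not vanish is a
  countable union of open sets of finite measure, so by inner regularity a sigma-compact subset carries
  all the integrals. For a Parseval frame \<open>R\<close> is the identity, and passing to the adjoint transposes the
  kernel.
\<close>

section \<open>Complex Hilbert spaces\<close>

lemma cinner_zero_left [simp]: "cinner 0 y = 0"
  using cinner_add_left[of 0 0 y] by simp

lemma cinner_zero_right [simp]: "cinner x 0 = 0"
  using cinner_commute[of x 0] by simp

lemma cinner_add_right: "cinner x (y + z) = cinner x y + cinner x z"
  by (subst (1 2 3) cinner_commute) (simp add: cinner_add_left)

lemma cinner_scaleC_right: "cinner x (c *\<^sub>C y) = cnj c * cinner x y"
  by (subst (1 2) cinner_commute) (simp add: cinner_scaleC_left)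

lemma cinner_scaleR_left: "cinner (r *\<^sub>R x) y = r *\<^sub>R cinner x y"
  by (simp add: cinner_scaleC_left scaleR_conv_of_real flip: scaleC_of_real)

lemma cinner_scaleR_right: "cinner x (r *\<^sub>R y) = r *\<^sub>R cinner x y"
  by (simp add: cinner_scaleC_right scaleR_conv_of_real flip: scaleC_of_real)

lemma cinner_self: "cinner x x = complex_of_real ((norm x)\<^sup>2)"
proof -
  have im: "Im (cinner x x) = 0"
    using arg_cong[OF cinner_commute[of x x], of Im] by simp
  \<comment> \<open>In HOL \<open>sqrt\<close> is odd, so a negative radicand would have a negative
    root. Nonnegativity of the norm excludes this, and squaring then undoes the root.\<close>
  have "(0::real) \<le> sqrt (Re (cinner x x))"
    using norm_eq_sqrt_cinner[of x] norm_ge_zero[of x] by linarith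
  then have "(norm x)\<^sup>2 = Re (cinner x x)"
    by (simp add: norm_eq_sqrt_cinner[of x])
  with im show ?thesis
    by (simp add: complex_eq_iff)
qed

lemma Re_cinner_commute: "Re (cinner x y) = Re (cinner y x)"
  by (subst cinner_commute) simp

lemma norm_cinner_commute: "cmod (cinner x y) = cmod (cinner y x)"
  by (subst cinner_commute) simp

lemma norm_scaleC: "norm (c *\<^sub>C x) = cmod c * norm x"
proof -
  have "complex_of_real ((norm (c *\<^sub>C x))\<^sup>2) = complex_of_real ((cmod c * norm x)\<^sup>2)"
    unfolding cinner_self[symmetric] cinner_scaleC_left cinner_scaleC_right
    using complex_norm_square[of c] by (simp add: cinner_self power_mult_distrib ac_simps)
  then have "(norm (c *\<^sub>C x))\<^sup>2 = (cmod c * norm x)\<^sup>2"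
    by (simp only: of_real_eq_iff)
  then show ?thesis
    by (simp add: power2_eq_iff_nonneg)
qed

lemma scaleC_zero_right [simp]: "c *\<^sub>C (0::'a::complex_inner) = 0"
  using norm_scaleC[of c "0::'a"] by simp

lemma scaleC_zero_left [simp]: "0 *\<^sub>C (x::'a::complex_inner) = 0"
  using norm_scaleC[of 0 x] by simp

lemma scaleC_one [simp]: "1 *\<^sub>C (x::'a::complex_inner) = x"
  using scaleC_of_real[of 1 x] by simp

text \<open>The triangle inequality already belongs to the norm, so this half of Cauchy-Schwarz is
  read off by comparing the expansions of both of its squared sides.\<close>

lemma Re_cinner_le: "Re (cinner x y) \<le> norm x * norm y"
proof -
  have "complex_of_real ((norm (x + y))\<^sup>2) = of_real ((norm x)\<^sup>2) + cinner y x + cinner x y + of_real ((norm y)\<^sup>2)"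
    by (simp only: cinner_self[symmetric] cinner_add_left cinner_add_right add.assoc)
  from arg_cong[OF this, of Re]
  have "(norm (x + y))\<^sup>2 = (norm x)\<^sup>2 + 2 * Re (cinner x y) + (norm y)\<^sup>2"
    using Re_cinner_commute[of x y] by simp
  moreover have "(norm (x + y))\<^sup>2 \<le> (norm x + norm y)\<^sup>2"
    by (intro power_mono norm_triangle_ineq) simp
  ultimately show ?thesis
    by (simp add: power2_sum)
qed

text \<open>Multiplying \<open>x\<close> by a scalar of modulus one makes the inner product real and
  nonnegative, which reduces the claim to the bound on real parts.\<close>

lemma norm_cinner_le: "cmod (cinner x y) \<le> norm x * norm y"
proof (cases "cinner x y = 0")
  case False
  define c where "c = cnj (sgn (cinner x y))"
  have "c * cinner x y = of_real (cmod (cinner x y))"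
    using False complex_norm_square[of "cinner x y"]
    by (simp add: c_def sgn_eq field_simps power2_eq_square)
  then have "cmod (cinner x y) = Re (cinner (c *\<^sub>C x) y)"
    by (simp add: cinner_scaleC_left)
  also have "\<dots> \<le> norm (c *\<^sub>C x) * norm y"
    by (rule Re_cinner_le)
  also have "norm (c *\<^sub>C x) = norm x"
    using False by (simp add: norm_scaleC c_def norm_sgn)
  finally show ?thesis .
qed simp

lemma bounded_bilinear_cinner: "bounded_bilinear cinner"
  by standard (auto simp: cinner_add_left cinner_add_right cinner_scaleR_left cinner_scaleR_right
      intro!: exI[of _ 1] norm_cinner_le)

lemmas cinner_diff_left = bounded_bilinear.diff_left[OF bounded_bilinear_cinner]

lemma cinner_eqI:
  assumes "\<And>g. cinner x g = cinner y g" shows "x = y"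
proof -
  have "cinner (x - y) (x - y) = 0"
    using assms by (simp add: cinner_diff_left)
  then show ?thesis by (simp add: cinner_self)
qed

section \<open>Representation of functionals and Riesz' theorem\<close>

text \<open>The representing vector minimises the energy \<open>b x x - 2 \<phi> x\<close>; minimising sequences are Cauchy
  by the parallelogram identity.\<close>

lemma coercive_form_representation:
  fixes b :: "'a::banach \<Rightarrow> 'a \<Rightarrow> real"
  assumes b: "bounded_bilinear b" and sym: "\<And>x y. b x y = b y x"
    and c: "c > 0" "\<And>x. c * (norm x)\<^sup>2 \<le> b x x"
    and \<phi>: "bounded_linear \<phi>"
  shows "\<exists>x. \<forall>y. b x y = \<phi> y"
proof -
  interpret b: bounded_bilinear b by fact
  interpret \<phi>: bounded_linear \<phi> by fact
  define J where "J x = b x x - 2 * \<phi> x" for x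
  obtain K where K: "\<And>x. norm (\<phi> x) \<le> norm x * K"
    using \<phi>.bounded by blast
  have J_ge: "- K\<^sup>2 / c \<le> J x" for x
  proof -
    \<comment> \<open>Completing the square in \<open>norm x\<close> shows that the quadratic term
      outweighs the linear one.\<close>
    have "0 \<le> (c * norm x - K)\<^sup>2 / c"
      using c(1) by simp
    also have "\<dots> = c * (norm x)\<^sup>2 - 2 * (norm x * K) + K\<^sup>2 / c"
      using c(1) by (simp add: field_simps power2_eq_square)
    also have "\<dots> \<le> J x + K\<^sup>2 / c"
      using c(2)[of x] K[of x] by (auto simp: J_def)
    finally show ?thesis by simp
  qed
  then have bdd: "bdd_below (range J)"
    by (auto simp: bdd_below_def)
  define m where "m = Inf (range J)"
  have m_le: "m \<le> J x" for x
    unfolding m_def by (rule cInf_lower[OF _ bdd]) simp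
  have "\<exists>x. J x < m + 1 / real (Suc n)" for n
    using cInf_lessD[of "range J" "m + 1 / real (Suc n)"] by (auto simp: m_def)
  then obtain X where X: "\<And>n. J (X n) < m + 1 / real (Suc n)"
    by metis
  have par: "c / 2 * (norm (x - y))\<^sup>2 \<le> J x + J y - 2 * m" for x y
  proof -
    have "c / 2 * (norm (x - y))\<^sup>2 \<le> b (x - y) (x - y) / 2"
      using c(2)[of "x - y"] by simp
    also have "\<dots> = J x + J y - 2 * J ((1/2) *\<^sub>R (x + y))"
      using sym[of x y]
      by (simp add: J_def b.diff_left b.diff_right b.add_left b.add_right b.scaleR_left
          b.scaleR_right \<phi>.add \<phi>.scaleR field_simps)
    also have "\<dots> \<le> J x + J y - 2 * m"
      using m_le by simp
    finally show ?thesis .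
  qed
  have "Cauchy X"
  proof (rule metric_CauchyI)
    fix e :: real assume "e > 0"
    with c(1) have pos: "c / 4 * e\<^sup>2 > 0" by simp
    then obtain N where N: "1 / real (Suc N) < c / 4 * e\<^sup>2"
      using reals_Archimedean by (metis inverse_eq_divide)
    have "dist (X i) (X j) < e" if "i \<ge> N" "j \<ge> N" for i j
    proof -
      have le: "1 / real (Suc k) \<le> 1 / real (Suc N)" if "k \<ge> N" for k
        using that by (simp add: field_simps)
      have "c / 2 * (norm (X i - X j))\<^sup>2 \<le> J (X i) + J (X j) - 2 * m"
        by (rule par)
      also have "\<dots> < 2 * (1 / real (Suc N))"
        using X[of i] X[of j] le[OF that(1)] le[OF that(2)] by linarith
      also have "\<dots> < c / 2 * e\<^sup>2" using N by simp
      finally have "(norm (X i - X j))\<^sup>2 < e\<^sup>2"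
        using c(1) by simp
      then show ?thesis
        using \<open>e > 0\<close> by (simp add: dist_norm power_less_imp_less_base)
    qed
    then show "\<exists>N. \<forall>i\<ge>N. \<forall>j\<ge>N. dist (X i) (X j) < e" by blast
  qed
  then obtain x where x: "X \<longlonglongrightarrow> x"
    using Cauchy_convergent convergent_def by blast
  have "(\<lambda>n. J (X n)) \<longlonglongrightarrow> J x"
    unfolding J_def by (intro tendsto_intros b.tendsto \<phi>.tendsto x)
  moreover have "(\<lambda>n. m + 1 / real (Suc n)) \<longlonglongrightarrow> m + 0"
    by (intro tendsto_add tendsto_const LIMSEQ_Suc[OF lim_1_over_n])
  ultimately have "J x \<le> m + 0"
    by (rule LIMSEQ_le) (use X less_imp_le in blast)
  then have min: "J x \<le> J y" for y
    using m_le[of y] by simp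
  have "b x y = \<phi> y" for y
  proof -
    define d where "d = b x y - \<phi> y"
    \<comment> \<open>First variation: the minimiser \<open>x\<close> is compared with the points of
      the line through it in direction \<open>y\<close>.\<close>
    have quad: "0 \<le> 2 * t * d + t\<^sup>2 * b y y" for t
      using min[of "x + t *\<^sub>R y"] sym[of x y]
      by (simp add: J_def d_def b.add_left b.add_right b.scaleR_left b.scaleR_right
          \<phi>.add \<phi>.scaleR algebra_simps power2_eq_square)
    have nn: "b y y \<ge> 0"
      using c(1) c(2)[of y] by (smt (verit) mult_nonneg_nonneg zero_le_power2)
    \<comment> \<open>One is added so that division is safe when \<open>b y y = 0\<close>. At
      \<open>t = - d / k\<close> the quadratic is \<open>- d\<^sup>2 * (k + 1) / k\<^sup>2\<close>,
      which is nonnegative only if \<open>d = 0\<close>.\<close>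
    define k where "k = b y y + 1"
    have k: "k \<ge> 1" using nn by (simp add: k_def)
    have "0 \<le> 2 * (- d / k) * d + (- d / k)\<^sup>2 * b y y"
      by (rule quad)
    also have "\<dots> = - (d\<^sup>2 * (k + 1)) / k\<^sup>2"
      using k by (simp add: k_def[symmetric] field_simps power2_eq_square) (simp add: k_def algebra_simps)
    finally have "d\<^sup>2 * (k + 1) \<le> 0"
      using k by (simp add: divide_le_0_iff)
    then have "d = 0"
      using k by (simp add: mult_le_0_iff)
    then show ?thesis by (simp add: d_def)
  qed
  then show ?thesis by blast
qed

text \<open>The real part of a Hermitian coercive form is a real symmetric one, so the previous
  lemma matches the real parts. Replacing \<open>y\<close> by \<open>\<i> *\<^sub>C y\<close> then
  matches the imaginary parts, since both sides are conjugate-linear in \<open>y\<close>. The inner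
  product as \<open>q\<close> gives Riesz' theorem, the frame form gives surjectivity of the frame
  operator.\<close>

lemma coercive_sesquilinear_representation:
  fixes q :: "'h::complex_hilbert_space \<Rightarrow> 'h \<Rightarrow> complex"
  assumes q: "bounded_bilinear q" "\<And>a x y. q x (a *\<^sub>C y) = cnj a * q x y"
    and herm: "\<And>x y. q x y = cnj (q y x)"
    and c: "c > 0" "\<And>x. c * (norm x)\<^sup>2 \<le> Re (q x x)"
    and \<phi>: "bounded_linear \<phi>" "\<And>a y. \<phi> (a *\<^sub>C y) = cnj a * \<phi> y"
  shows "\<exists>x. \<forall>y. q x y = \<phi> y"
proof -
  have "\<exists>x. \<forall>y. Re (q x y) = Re (\<phi> y)"
  proof (rule coercive_form_representation)
    show "bounded_bilinear (\<lambda>x y. Re (q x y))"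
    proof -
      interpret q: bounded_bilinear q by fact
      show ?thesis
        using q.bounded order_trans[OF abs_Re_le_cmod]
        by unfold_locales (simp_all add: q.add_left q.add_right q.scaleR_left q.scaleR_right, blast)
    qed
    show "Re (q x y) = Re (q y x)" for x y
      using herm[of x y] by simp
    show "bounded_linear (\<lambda>y. Re (\<phi> y))"
      using bounded_linear_compose[OF bounded_linear_Re \<phi>(1)] .
  qed (use c in auto)
  then obtain x where x: "\<And>y. Re (q x y) = Re (\<phi> y)" by blast
  have "q x y = \<phi> y" for y
    using x[of y] x[of "\<i> *\<^sub>C y"] by (simp add: q(2) \<phi>(2) complex_eq_iff)
  then show ?thesis by blast
qed

lemma riesz_representation:
  fixes \<phi> :: "'h::complex_hilbert_space \<Rightarrow> complex"
  assumes "bounded_linear \<phi>" "\<And>a y. \<phi> (a *\<^sub>C y) = cnj a * \<phi> y"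
  shows "\<exists>x. \<forall>y. cinner x y = \<phi> y"
proof (rule coercive_sesquilinear_representation[OF bounded_bilinear_cinner _ _ _ _ assms])
  show "cinner x (a *\<^sub>C y) = cnj a * cinner x y" for a and x y :: 'h
    by (rule cinner_scaleC_right)
  show "cinner x y = cnj (cinner y x)" for x y :: 'h
    by (rule cinner_commute)
  show "1 * (norm x)\<^sup>2 \<le> Re (cinner x x)" for x :: 'h
    by (simp add: cinner_self)
qed simp

section \<open>Bounded complex-linear operators and their adjoints\<close>

lemma bounded_linear_scaleC: "bounded_linear (\<lambda>x::'a::complex_inner. c *\<^sub>C x)"
proof (rule bounded_linear_intro)
  show "c *\<^sub>C (r *\<^sub>R x) = r *\<^sub>R (c *\<^sub>C x)" for r and x :: 'a
    by (simp add: scaleC_scaleC mult.commute flip: scaleC_of_real)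
  show "norm (c *\<^sub>C x) \<le> norm x * cmod c" for x :: 'a
    by (simp add: norm_scaleC mult.commute)
qed (rule scaleC_add_right)

lemma bounded_clinear_zero: "bounded_clinear (\<lambda>h. 0)"
  by (simp add: bounded_clinear_def)

lemma bounded_clinear_add:
  "bounded_clinear S \<Longrightarrow> bounded_clinear T \<Longrightarrow> bounded_clinear (\<lambda>h. S h + T h)"
  by (simp add: bounded_clinear_def bounded_linear_add scaleC_add_right)

lemma bounded_clinear_scaleC: "bounded_clinear T \<Longrightarrow> bounded_clinear (\<lambda>h. c *\<^sub>C T h)"
  by (simp add: bounded_clinear_def bounded_linear_compose[OF bounded_linear_scaleC]
      scaleC_scaleC mult.commute)

lemma bounded_clinear_compose:
  "bounded_clinear S \<Longrightarrow> bounded_clinear T \<Longrightarrow> bounded_clinear (S \<circ> T)"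
  by (simp add: bounded_clinear_def bounded_linear_compose o_def)

lemma bounded_clinear_simps:
  assumes "bounded_clinear T"
  shows "T (g + h) = T g + T h" "T (c *\<^sub>C h) = c *\<^sub>C T h" "T 0 = 0"
proof -
  interpret T: bounded_linear T using assms by (simp add: bounded_clinear_def)
  show "T (g + h) = T g + T h" "T 0 = 0" by (rule T.add, rule T.zero)
  show "T (c *\<^sub>C h) = c *\<^sub>C T h" using assms by (simp add: bounded_clinear_def)
qed

lemma bounded_clinear_adjoint_exists:
  fixes T :: "'h::complex_hilbert_space \<Rightarrow> 'h"
  assumes T: "bounded_clinear T"
  shows "\<exists>A. bounded_clinear A \<and> (\<forall>x y. cinner (T x) y = cinner x (A y))"
proof -
  have bl: "bounded_linear T" and sc: "\<And>c x. T (c *\<^sub>C x) = c *\<^sub>C T x"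
    using T by (auto simp: bounded_clinear_def)
  have "\<exists>s. \<forall>x. cinner s x = cinner y (T x)" for y
    by (rule riesz_representation)
       (auto simp: sc cinner_scaleC_right intro: bounded_linear_compose[OF
          bounded_bilinear.bounded_linear_right[OF bounded_bilinear_cinner] bl])
  then obtain A where "\<And>y x. cinner (A y) x = cinner y (T x)" by metis
  then have A: "cinner (T x) y = cinner x (A y)" for x y
    by (metis cinner_commute)
  have A': "cinner (A y) x = cinner y (T x)" for x y
    by (metis A cinner_commute)
  obtain K where K: "\<And>x. norm (T x) \<le> norm x * K" "K \<ge> 0"
    using bounded_linear.nonneg_bounded[OF bl] by blast
  \<comment> \<open>The adjoint identity tested at \<open>A y\<close> itself bounds
    \<open>(norm (A y))\<^sup>2\<close> by \<open>norm y * norm (A y) * K\<close>, and one factor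
    cancels.\<close>
  have "norm (A y) \<le> norm y * K" for y
  proof (cases "A y = 0")
    case False
    have "norm (A y) * norm (A y) = cmod (cinner y (T (A y)))"
      using A'[of y "A y"] by (metis cinner_self norm_of_real abs_power2 power2_eq_square)
    also have "\<dots> \<le> norm y * norm (T (A y))" by (rule norm_cinner_le)
    also have "\<dots> \<le> norm y * (norm (A y) * K)" by (intro mult_left_mono K) simp
    finally have "norm (A y) * norm (A y) \<le> (norm y * K) * norm (A y)" by (simp add: ac_simps)
    with False show ?thesis by simp
  qed (use K in simp)
  moreover have "A (y + z) = A y + A z" for y z
    by (rule cinner_eqI) (simp add: A' cinner_add_left)
  moreover have "A (r *\<^sub>R y) = r *\<^sub>R A y" for r y
    by (rule cinner_eqI) (simp add: A' cinner_scaleR_left)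
  ultimately have "bounded_linear A"
    by (intro bounded_linear_intro)
  moreover have "A (c *\<^sub>C y) = c *\<^sub>C A y" for c y
    by (rule cinner_eqI) (simp add: A' cinner_scaleC_left)
  ultimately show ?thesis using A by (auto simp: bounded_clinear_def)
qed

text \<open>The inner product separates points, so the definite description is determined by the
  adjoint identity. The star identities below are all obtained from this rule.\<close>

lemma cadjoint_eqI:
  assumes "\<And>x y. cinner (T x) y = cinner x (A y)" shows "cadjoint T = A"
  unfolding cadjoint_def
proof (rule the_equality)
  fix B assume B: "\<forall>x y. cinner (T x) y = cinner x (B y)"
  have "B y = A y" for y
  proof (rule cinner_eqI)
    fix g
    have "cinner g (B y) = cinner g (A y)" using B assms by metis
    then show "cinner (B y) g = cinner (A y) g" by (metis cinner_commute)
  qed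
  then show "B = A" by blast
qed (use assms in blast)

lemma cadjoint:
  fixes T :: "'h::complex_hilbert_space \<Rightarrow> 'h"
  assumes "bounded_clinear T"
  shows bounded_clinear_cadjoint: "bounded_clinear (cadjoint T)"
    and cinner_cadjoint_right: "cinner x (cadjoint T y) = cinner (T x) y"
    and cinner_cadjoint_left: "cinner (cadjoint T y) x = cinner y (T x)"
proof -
  obtain A where A: "bounded_clinear A" "\<And>x y. cinner (T x) y = cinner x (A y)"
    using bounded_clinear_adjoint_exists[OF assms] by blast
  then have "cadjoint T = A" by (intro cadjoint_eqI)
  with A show "bounded_clinear (cadjoint T)" and *: "cinner x (cadjoint T y) = cinner (T x) y"
    by simp_all
  show "cinner (cadjoint T y) x = cinner y (T x)"
    using * by (subst (1 2) cinner_commute) simp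
qed

section \<open>Frame operators\<close>

text \<open>The frame bounds are parameters, so that the Parseval case is the instance in which both
  are 1.\<close>

locale bounded_frame =
  fixes \<mu> :: "'x::metric_space measure" and f :: "'x \<Rightarrow> 'h::complex_hilbert_space" and c C :: real
  assumes sets_eq: "sets \<mu> = sets borel"
    and frame: "continuous_frame_with_bounds \<mu> c C f"
    and c_pos: "0 < c" and C_pos: "0 < C"
begin

section \<open>The bounded sesquilinear form of a frame\<close>

lemma continuous_frame: "continuous_on UNIV f"
  using frame by (simp add: continuous_frame_with_bounds_def)

lemma continuous_imp_measurable: "continuous_on UNIV g \<Longrightarrow> g \<in> borel_measurable \<mu>"
  using borel_measurable_continuous_onI measurable_cong_sets[OF sets_eq refl] by blast

lemma cinner_frame_measurable [measurable]: "(\<lambda>x. cinner h (f x)) \<in> borel_measurable \<mu>"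
  and frame_cinner_measurable [measurable]: "(\<lambda>x. cinner (f x) h) \<in> borel_measurable \<mu>"
  by (intro continuous_imp_measurable bounded_bilinear.continuous_on[OF bounded_bilinear_cinner]
      continuous_on_const continuous_frame)+

text \<open>The finite upper frame bound makes the square integrable, after which both frame bounds
  pass from nonnegative integrals to real ones.\<close>

lemma integrable_frame_square: "integrable \<mu> (\<lambda>x. (cmod (cinner h (f x)))\<^sup>2)"
  and frame_square_ge: "c * (norm h)\<^sup>2 \<le> (\<integral>x. (cmod (cinner h (f x)))\<^sup>2 \<partial>\<mu>)"
  and frame_square_le: "(\<integral>x. (cmod (cinner h (f x)))\<^sup>2 \<partial>\<mu>) \<le> C * (norm h)\<^sup>2"
proof -
  let ?I = "\<integral>\<^sup>+x. ennreal ((cmod (cinner h (f x)))\<^sup>2) \<partial>\<mu>"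
  have I: "ennreal (c * (norm h)\<^sup>2) \<le> ?I" "?I \<le> ennreal (C * (norm h)\<^sup>2)"
    using frame by (auto simp: continuous_frame_with_bounds_def)
  show int: "integrable \<mu> (\<lambda>x. (cmod (cinner h (f x)))\<^sup>2)"
    using I(2) by (intro integrableI_bounded) (auto simp: less_top[symmetric] top_unique)
  have "?I = ennreal (\<integral>x. (cmod (cinner h (f x)))\<^sup>2 \<partial>\<mu>)"
    by (rule nn_integral_eq_integral[OF int]) simp
  with I show "c * (norm h)\<^sup>2 \<le> (\<integral>x. (cmod (cinner h (f x)))\<^sup>2 \<partial>\<mu>)"
    "(\<integral>x. (cmod (cinner h (f x)))\<^sup>2 \<partial>\<mu>) \<le> C * (norm h)\<^sup>2"
    using C_pos by (simp_all add: ennreal_le_iff integral_nonneg_AE)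
qed

text \<open>This is the form of the frame operator, usable before the weak integral defining that
  operator is known to exist.\<close>

definition frame_form :: "'h \<Rightarrow> 'h \<Rightarrow> complex"
  where "frame_form h g = (\<integral>x. cinner h (f x) * cinner (f x) g \<partial>\<mu>)"

lemma integrable_frame_form: "integrable \<mu> (\<lambda>x. cinner h (f x) * cinner (f x) g)"
proof (rule Bochner_Integration.integrable_bound)
  show "integrable \<mu> (\<lambda>x. (cmod (cinner h (f x)))\<^sup>2 + (cmod (cinner g (f x)))\<^sup>2)"
    by (intro Bochner_Integration.integrable_add integrable_frame_square)
  have "cmod (cinner h (f x) * cinner (f x) g)
      \<le> (cmod (cinner h (f x)))\<^sup>2 + (cmod (cinner g (f x)))\<^sup>2" for x
  proof -
    have "0 \<le> cmod (cinner h (f x)) * cmod (cinner g (f x))" by simp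
    with sum_squares_bound[of "cmod (cinner h (f x))" "cmod (cinner g (f x))"]
    have "cmod (cinner h (f x)) * cmod (cinner g (f x)) \<le> (cmod (cinner h (f x)))\<^sup>2 + (cmod (cinner g (f x)))\<^sup>2"
      by linarith
    then show ?thesis
      using norm_cinner_commute[of g "f x"] by (simp add: norm_mult)
  qed
  then show "AE x in \<mu>. norm (cinner h (f x) * cinner (f x) g)
      \<le> norm ((cmod (cinner h (f x)))\<^sup>2 + (cmod (cinner g (f x)))\<^sup>2)"
    by simp
qed measurable

lemma frame_form_self: "frame_form h h = of_real (\<integral>x. (cmod (cinner h (f x)))\<^sup>2 \<partial>\<mu>)"
proof -
  have "cinner h (f x) * cinner (f x) h = of_real ((cmod (cinner h (f x)))\<^sup>2)" for x
    using complex_norm_square[of "cinner h (f x)"] cinner_commute[of "f x" h] by simp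
  then show ?thesis by (simp only: frame_form_def integral_complex_of_real)
qed

lemma frame_form_commute: "frame_form h g = cnj (frame_form g h)"
proof -
  have "cinner h (f x) * cinner (f x) g = cnj (cinner g (f x) * cinner (f x) h)" for x
    using cinner_commute[of h "f x"] cinner_commute[of "f x" g] by simp
  then show ?thesis
    unfolding frame_form_def by (simp only: Bochner_Integration.integral_cnj)
qed

lemma frame_form_scaleC_right: "frame_form h (a *\<^sub>C g) = cnj a * frame_form h g"
  by (simp add: frame_form_def cinner_scaleC_right mult.left_commute)

text \<open>Cauchy-Schwarz for the integral comes from a weighted inequality of arithmetic and
  geometric means, integrated and combined with the upper frame bound.\<close>

lemma norm_frame_form_le: "cmod (frame_form h g) \<le> C * norm h * norm g"
proof (cases "h = 0 \<or> g = 0")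
  case False
  \<comment> \<open>With this weight both terms of the mean become
    \<open>C * norm h * norm g\<close>.\<close>
  define t where "t = norm g / norm h"
  have t: "t > 0" using False by (simp add: t_def)
  let ?a = "\<lambda>x. (cmod (cinner h (f x)))\<^sup>2" and ?b = "\<lambda>x. (cmod (cinner g (f x)))\<^sup>2"
  have le: "cmod (cinner h (f x) * cinner (f x) g) \<le> (t * ?a x + ?b x / t) / 2" for x
  proof -
    have "0 \<le> (t * cmod (cinner h (f x)) - cmod (cinner g (f x)))\<^sup>2 / t" using t by simp
    also have "\<dots> = t * ?a x + ?b x / t - 2 * (cmod (cinner h (f x)) * cmod (cinner g (f x)))"
      using t by (simp add: field_simps power2_eq_square)
    finally show ?thesis
      using norm_cinner_commute[of g "f x"] by (simp add: norm_mult)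
  qed
  have "cmod (frame_form h g) \<le> (\<integral>x. cmod (cinner h (f x) * cinner (f x) g) \<partial>\<mu>)"
    unfolding frame_form_def by (rule integral_norm_bound)
  also have "\<dots> \<le> (\<integral>x. (t * ?a x + ?b x / t) / 2 \<partial>\<mu>)"
    using integrable_frame_square[of h] integrable_frame_square[of g]
    by (intro integral_mono le integrable_norm integrable_frame_form) auto
  also have "\<dots> = (t * (\<integral>x. ?a x \<partial>\<mu>) + (\<integral>x. ?b x \<partial>\<mu>) / t) / 2"
    using integrable_frame_square[of h] integrable_frame_square[of g] by simp
  also have "\<dots> \<le> (t * (C * (norm h)\<^sup>2) + C * (norm g)\<^sup>2 / t) / 2"
    using t by (intro divide_right_mono add_mono mult_left_mono frame_square_le) auto
  also have "\<dots> = C * norm h * norm g"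
    using False by (simp add: t_def field_simps power2_eq_square)
  finally show ?thesis .
qed (auto simp: frame_form_def)

lemma bounded_bilinear_frame_form: "bounded_bilinear frame_form"
proof
  show "frame_form (h + h') g = frame_form h g + frame_form h' g" for h h' g
    using integrable_frame_form by (simp add: frame_form_def cinner_add_left distrib_right)
  show "frame_form h (g + g') = frame_form h g + frame_form h g'" for h g g'
    using integrable_frame_form by (simp add: frame_form_def cinner_add_right distrib_left)
  show "frame_form (r *\<^sub>R h) g = r *\<^sub>R frame_form h g" for r h g
    by (simp add: frame_form_def cinner_scaleR_left)
  show "frame_form h (r *\<^sub>R g) = r *\<^sub>R frame_form h g" for r h g
    by (simp add: frame_form_def cinner_scaleR_right)
  show "\<exists>K. \<forall>h g. norm (frame_form h g) \<le> norm h * norm g * K"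
    using norm_frame_form_le by (intro exI[of _ C]) (simp add: ac_simps)
qed

section \<open>The frame operator, its inverse and the reproducing formula\<close>

lemma has_weak_integral_frame_iff:
  "has_weak_integral \<mu> (\<lambda>x. cinner h (f x) *\<^sub>C f x) s \<longleftrightarrow> (\<forall>g. cinner s g = frame_form h g)"
  unfolding has_weak_integral_def
  using integrable_frame_form by (simp add: cinner_scaleC_left frame_form_def)

lemma frame_operator_eqI:
  assumes "\<And>g. cinner s g = frame_form h g" shows "frame_operator \<mu> f h = s"
  unfolding frame_operator_def weak_integral_def has_weak_integral_frame_iff
  using assms by (intro the_equality) (auto intro: cinner_eqI)

text \<open>Existence of the weak integral is Riesz' theorem for the bounded conjugate-linear
  functional \<open>frame_form h\<close>; only then does the definite description have a meaningful
  value.\<close>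

lemma cinner_frame_operator: "cinner (frame_operator \<mu> f h) g = frame_form h g"
proof -
  have "\<exists>s. \<forall>g. cinner s g = frame_form h g"
    by (rule riesz_representation)
       (auto simp: frame_form_scaleC_right bounded_bilinear.bounded_linear_right[OF bounded_bilinear_frame_form])
  then show ?thesis using frame_operator_eqI by metis
qed

lemma frame_form_ge: "c * (norm h)\<^sup>2 \<le> Re (frame_form h h)"
  using frame_square_ge by (simp add: frame_form_self)

text \<open>Coercivity of the frame form combined with Cauchy-Schwarz. It yields injectivity, and
  later the bound \<open>1 / c\<close> for the inverse.\<close>

lemma norm_frame_operator_ge: "c * norm h \<le> norm (frame_operator \<mu> f h)"
proof (cases "h = 0")
  case False
  have "c * norm h * norm h \<le> Re (cinner (frame_operator \<mu> f h) h)"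
    using frame_form_ge[of h] by (simp add: cinner_frame_operator power2_eq_square mult.assoc)
  also have "\<dots> \<le> norm (frame_operator \<mu> f h) * norm h"
    by (rule Re_cinner_le)
  finally show ?thesis using False by simp
qed simp

lemma frame_operator_add: "frame_operator \<mu> f (g + h) = frame_operator \<mu> f g + frame_operator \<mu> f h"
  by (intro frame_operator_eqI)
     (simp add: cinner_add_left cinner_frame_operator bounded_bilinear.add_left[OF bounded_bilinear_frame_form])

lemma frame_operator_scaleR: "frame_operator \<mu> f (r *\<^sub>R h) = r *\<^sub>R frame_operator \<mu> f h"
  by (intro frame_operator_eqI)
     (simp add: cinner_scaleR_left cinner_frame_operator bounded_bilinear.scaleR_left[OF bounded_bilinear_frame_form])

lemma bij_frame_operator: "bij (frame_operator \<mu> f)"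
proof (rule bijI)
  show "inj (frame_operator \<mu> f)"
  proof (rule injI)
    fix g h assume "frame_operator \<mu> f g = frame_operator \<mu> f h"
    then have "frame_operator \<mu> f (g + (-1) *\<^sub>R h) = 0"
      unfolding frame_operator_add frame_operator_scaleR by simp
    then have "c * norm (g - h) \<le> 0"
      using norm_frame_operator_ge[of "g - h"] by simp
    then show "g = h" using c_pos by (simp add: mult_le_0_iff)
  qed
  have "\<exists>h. frame_operator \<mu> f h = s" for s
  proof -
    \<comment> \<open>Surjectivity: a preimage of \<open>s\<close> is a vector whose frame form
      represents the functional \<open>cinner s\<close>.\<close>
    have "\<exists>h. \<forall>g. frame_form h g = cinner s g"
      by (rule coercive_sesquilinear_representation[OF bounded_bilinear_frame_form
            frame_form_scaleC_right frame_form_commute c_pos frame_form_ge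
            bounded_bilinear.bounded_linear_right[OF bounded_bilinear_cinner] cinner_scaleC_right])
    then show ?thesis using frame_operator_eqI by metis
  qed
  then show "surj (frame_operator \<mu> f)" by (metis surjI)
qed

lemma frame_operator_inv: "frame_operator \<mu> f (inv (frame_operator \<mu> f) g) = g"
  using bij_frame_operator by (simp add: bij_def surj_f_inv_f)

lemma inv_frame_operator: "inv (frame_operator \<mu> f) (frame_operator \<mu> f g) = g"
  using bij_frame_operator by (simp add: bij_def)

lemma bounded_linear_inv_frame_operator: "bounded_linear (inv (frame_operator \<mu> f))" (is "bounded_linear ?R")
proof (rule bounded_linear_intro[where K = "1 / c"])
  show "?R (g + h) = ?R g + ?R h" for g h
    by (metis frame_operator_add frame_operator_inv inv_frame_operator)
  show "?R (r *\<^sub>R h) = r *\<^sub>R ?R h" for r h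
    by (metis frame_operator_scaleR frame_operator_inv inv_frame_operator)
  show "norm (?R h) \<le> norm h * (1 / c)" for h
    using norm_frame_operator_ge[of "?R h"] c_pos by (simp add: frame_operator_inv field_simps)
qed

text \<open>Consequently the operator kernels vanish off the support of \<open>f\<close> in both
  variables, which the transposed kernels need as well.\<close>

lemma canonical_dual_eq_0: "f x = 0 \<Longrightarrow> canonical_dual \<mu> f x = 0"
  by (simp add: canonical_dual_def linear_0 bounded_linear_inv_frame_operator bounded_linear.linear)

lemma frame_operator_selfadjoint: "cinner (frame_operator \<mu> f h) g = cinner h (frame_operator \<mu> f g)"
  by (metis cinner_commute cinner_frame_operator frame_form_commute)

lemma inv_frame_operator_selfadjoint:
  "cinner (inv (frame_operator \<mu> f) h) g = cinner h (inv (frame_operator \<mu> f) g)"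
  by (metis frame_operator_inv frame_operator_selfadjoint)

text \<open>Self-adjointness is used twice: it inserts the frame operator on \<open>h\<close>
  against its inverse on \<open>g\<close>, and after expansion by the frame form it moves the
  inverse onto the frame vector.\<close>

lemma frame_reproducing:
  "cinner h g = (\<integral>x. cinner h (f x) * cinner (canonical_dual \<mu> f x) g \<partial>\<mu>)"
proof -
  let ?R = "inv (frame_operator \<mu> f)"
  have "cinner h g = cinner (frame_operator \<mu> f h) (?R g)"
    by (simp add: frame_operator_selfadjoint frame_operator_inv)
  also have "\<dots> = (\<integral>x. cinner h (f x) * cinner (canonical_dual \<mu> f x) g \<partial>\<mu>)"
    by (simp add: cinner_frame_operator frame_form_def canonical_dual_def inv_frame_operator_selfadjoint)
  finally show ?thesis .
qed

text \<open>The reproducing formula tested against \<open>cadjoint S g\<close>, with absolute values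
  taken inside. For \<open>h\<close> the image under \<open>T\<close> of a dual vector and
  \<open>g\<close> a frame vector, it dominates the kernel of \<open>S \<circ> T\<close>.\<close>

lemma norm_cinner_le_kernel_composition:
  assumes S: "bounded_clinear S"
  shows "ennreal (cmod (cinner (S h) g)) \<le>
    (\<integral>\<^sup>+z. ennreal (cmod (cinner h (f z)) * cmod (cinner (S (canonical_dual \<mu> f z)) g)) \<partial>\<mu>)"
proof -
  let ?F = "\<lambda>z. cinner h (f z) * cinner (S (canonical_dual \<mu> f z)) g"
  \<comment> \<open>Moving \<open>S\<close> and the inverse to the other side gives an integrand of
    the frame form, which is known to be integrable.\<close>
  have eq: "?F = (\<lambda>z. cinner h (f z) * cinner (f z) (inv (frame_operator \<mu> f) (cadjoint S g)))"
    using S by (simp add: canonical_dual_def inv_frame_operator_selfadjoint cinner_cadjoint_right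
        flip: inv_frame_operator_selfadjoint)
  have int: "integrable \<mu> ?F"
    unfolding eq by (rule integrable_frame_form)
  have "cinner (S h) g = (\<integral>z. ?F z \<partial>\<mu>)"
    using frame_reproducing[of h "cadjoint S g"] S by (simp add: cinner_cadjoint_right)
  with integral_norm_bound_ennreal[OF int] show ?thesis
    by (simp add: norm_mult)
qed

end

text \<open>The quadratic forms of the frame and of the inner product coincide. Polarisation at
  \<open>h + g\<close> gives equal real parts, and \<open>\<i> *\<^sub>C g\<close> the imaginary
  ones.\<close>

lemma frame_operator_parseval:
  assumes "bounded_frame \<mu> f 1 1"
  shows "frame_operator \<mu> f = id"
proof -
  interpret bounded_frame \<mu> f 1 1 by fact
  interpret q: bounded_bilinear frame_form by (rule bounded_bilinear_frame_form)
  have self: "frame_form h h = cinner h h" for h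
    using frame_square_ge[of h] frame_square_le[of h] by (simp add: frame_form_self cinner_self)
  have Re_eq: "Re (frame_form h g) = Re (cinner h g)" for h g
  proof -
    have "frame_form h g + frame_form g h = cinner h g + cinner g h"
      using self[of "h + g"] self[of h] self[of g]
      by (simp add: q.add_left q.add_right cinner_add_left cinner_add_right add.commute)
    from arg_cong[OF this, of Re] show ?thesis
      using Re_cinner_commute[of g h] arg_cong[OF frame_form_commute[of g h], of Re] by simp
  qed
  have "frame_form h g = cinner h g" for h g
    using Re_eq[of h g] Re_eq[of h "\<i> *\<^sub>C g"]
    by (simp add: frame_form_scaleC_right cinner_scaleC_right complex_eq_iff)
  then show ?thesis by (auto simp: fun_eq_iff intro!: frame_operator_eqI)
qed

section \<open>Localized kernels\<close>

definition schur_tail ::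
    "'x::metric_space measure \<Rightarrow> ('x \<Rightarrow> real) \<Rightarrow> ('x \<Rightarrow> 'x \<Rightarrow> real) \<Rightarrow> real \<Rightarrow> ennreal"
  where "schur_tail \<mu> p k R =
    (SUP x. ennreal (1 / p x) * (\<integral>\<^sup>+y\<in>- cball x R. ennreal (k x y * p y) \<partial>\<mu>))"

text \<open>The condition is one-sided, on rows only. Columns are rows of the transposed kernel, so
  each estimate is proved once and applied twice.\<close>

definition schur_localized ::
    "'x::metric_space measure \<Rightarrow> ('x \<Rightarrow> real) \<Rightarrow> ('x \<Rightarrow> 'x \<Rightarrow> real) \<Rightarrow> bool"
  where "schur_localized \<mu> p k \<longleftrightarrow>
    (\<exists>M::real. \<forall>x. (\<integral>\<^sup>+y. ennreal (k x y * p y) \<partial>\<mu>) \<le> ennreal (M * p x)) \<and>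
    (schur_tail \<mu> p k \<longlongrightarrow> 0) at_top"

lemma weakly_localized_pair_iff:
  assumes "\<And>x. p x > 0"
  shows "weakly_localized_pair \<mu> p k g \<longleftrightarrow>
    schur_localized \<mu> p (\<lambda>x y. cmod (cinner (k x) (g y))) \<and>
    schur_localized \<mu> p (\<lambda>y x. cmod (cinner (k x) (g y)))" (is "?W \<longleftrightarrow> ?A \<and> ?B")
proof
  assume ?W
  then show "?A \<and> ?B"
    unfolding weakly_localized_pair_def schur_localized_def schur_tail_def by blast
next
  assume AB: "?A \<and> ?B"
  then obtain M N :: real
    where M: "\<And>x. (\<integral>\<^sup>+y. ennreal (cmod (cinner (k x) (g y)) * p y) \<partial>\<mu>) \<le> ennreal (M * p x)"
      and N: "\<And>y. (\<integral>\<^sup>+x. ennreal (cmod (cinner (k x) (g y)) * p x) \<partial>\<mu>) \<le> ennreal (N * p y)"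
    unfolding schur_localized_def by blast
  \<comment> \<open>A localized pair has a single constant for rows and columns; the larger of the
    two serves because \<open>p\<close> is positive.\<close>
  have "ennreal (M * p x) \<le> ennreal (max M N * p x)"
    and "ennreal (N * p x) \<le> ennreal (max M N * p x)" for x
    using assms[of x] by (auto intro!: ennreal_leI mult_right_mono)
  with M N AB show ?W
    unfolding weakly_localized_pair_def schur_localized_def schur_tail_def
    by (blast intro: order_trans)
qed

lemma schur_tail_bound:
  assumes "p x > 0"
  shows "(\<integral>\<^sup>+y\<in>- cball x R. ennreal (k x y * p y) \<partial>\<mu>) \<le> schur_tail \<mu> p k R * ennreal (p x)"
    (is "?I \<le> _")
proof -
  have "?I = ennreal (p x * (1 / p x)) * ?I"
    using assms by simp
  also have "\<dots> = (ennreal (1 / p x) * ?I) * ennreal (p x)"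
    using assms by (subst ennreal_mult) (auto simp: ac_simps)
  also have "\<dots> \<le> schur_tail \<mu> p k R * ennreal (p x)"
    unfolding schur_tail_def by (intro mult_right_mono SUP_upper) auto
  finally show ?thesis .
qed

text \<open>The estimates run in \<open>ennreal\<close>, so the real constant is turned into a
  finite extended one; a negative constant becomes 0 there.\<close>

lemma schur_localizedE:
  assumes "schur_localized \<mu> p k" "\<And>x. p x > 0"
  obtains M where "M < top" "\<And>x. (\<integral>\<^sup>+y. ennreal (k x y * p y) \<partial>\<mu>) \<le> M * ennreal (p x)"
proof -
  obtain M :: real where M: "\<And>x. (\<integral>\<^sup>+y. ennreal (k x y * p y) \<partial>\<mu>) \<le> ennreal (M * p x)"
    using assms(1) by (auto simp: schur_localized_def)
  have "ennreal (M * p x) = ennreal M * ennreal (p x)" for x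
    using assms(2)[of x] by (simp add: ennreal_mult'')
  with M show ?thesis by (intro that[of "ennreal M"]) auto
qed

text \<open>Shared last step of the closure proofs: the tail is squeezed between 0 and a finite
  combination of vanishing tails. The radius factor \<open>t\<close> is 1 for linear combinations
  and 1/2 for compositions.\<close>

lemma schur_localizedI:
  assumes "schur_localized \<mu> p k1" "schur_localized \<mu> p k2" and p: "\<And>x. p x > 0"
    and fin: "A < top" "a < top" "b < top" and t: "t > 0"
    and bound: "\<And>x. (\<integral>\<^sup>+y. ennreal (k x y * p y) \<partial>\<mu>) \<le> A * ennreal (p x)"
    and tail: "\<And>x R. (\<integral>\<^sup>+y\<in>- cball x R. ennreal (k x y * p y) \<partial>\<mu>)
      \<le> (a * schur_tail \<mu> p k1 (t * R) + b * schur_tail \<mu> p k2 (t * R)) * ennreal (p x)"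
  shows "schur_localized \<mu> p k"
proof -
  have "A * ennreal (p x) = ennreal (enn2real A * p x)" for x
    using p[of x] fin(1) by (simp add: ennreal_mult'')
  with bound have 1: "\<exists>M::real. \<forall>x. (\<integral>\<^sup>+y. ennreal (k x y * p y) \<partial>\<mu>) \<le> ennreal (M * p x)"
    by metis
  let ?u = "\<lambda>R. a * schur_tail \<mu> p k1 (t * R) + b * schur_tail \<mu> p k2 (t * R)"
  have le: "schur_tail \<mu> p k R \<le> ?u R" for R
    unfolding schur_tail_def[of \<mu> p k]
  proof (rule SUP_least)
    fix x
    have "ennreal (1 / p x) * (\<integral>\<^sup>+y\<in>- cball x R. ennreal (k x y * p y) \<partial>\<mu>)
        \<le> ennreal (1 / p x) * (?u R * ennreal (p x))"
      by (intro mult_left_mono tail) simp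
    also have "\<dots> = ?u R * ennreal (1 / p x * p x)"
      using p[of x] by (subst ennreal_mult) (auto simp: ac_simps)
    also have "\<dots> = ?u R" using p[of x] by simp
    finally show "ennreal (1 / p x) * (\<integral>\<^sup>+y\<in>- cball x R. ennreal (k x y * p y) \<partial>\<mu>) \<le> ?u R" .
  qed
  have lim: "filterlim (\<lambda>R. t * R) at_top at_top"
    using t by (intro filterlim_tendsto_pos_mult_at_top[OF tendsto_const] filterlim_ident)
  have "((\<lambda>R. schur_tail \<mu> p k1 (t * R)) \<longlongrightarrow> 0) at_top"
    "((\<lambda>R. schur_tail \<mu> p k2 (t * R)) \<longlongrightarrow> 0) at_top"
    using assms(1,2) by (auto simp: schur_localized_def intro: filterlim_compose[OF _ lim])
  then have "(?u \<longlongrightarrow> a * 0 + b * 0) at_top"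
    by (intro tendsto_add ennreal_tendsto_cmult fin)
  then have "(?u \<longlongrightarrow> 0) at_top" by simp
  then have "(schur_tail \<mu> p k \<longlongrightarrow> 0) at_top"
    by (rule tendsto_sandwich[where f = "\<lambda>_. 0", rotated 3]) (auto simp: le)
  with 1 show ?thesis by (simp add: schur_localized_def)
qed

lemma schur_localized_zero: "schur_localized \<mu> p (\<lambda>x y. 0)"
  by (auto simp: schur_localized_def schur_tail_def[abs_def] intro: exI[of _ 0])

text \<open>Monotonicity and linearity of the integral make pointwise domination sufficient, which
  covers both sums and scalar multiples.\<close>

lemma schur_localized_combination:
  assumes loc: "schur_localized \<mu> p k1" "schur_localized \<mu> p k2" and p: "\<And>x. p x > 0"
    and sets: "sets \<mu> = sets borel"
    and [measurable]: "p \<in> borel_measurable \<mu>"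
      "\<And>x. k1 x \<in> borel_measurable \<mu>" "\<And>x. k2 x \<in> borel_measurable \<mu>"
    and nn: "\<And>x y. 0 \<le> k1 x y" "\<And>x y. 0 \<le> k2 x y" "0 \<le> a" "0 \<le> b"
    and le: "\<And>x y. k x y \<le> a * k1 x y + b * k2 x y"
  shows "schur_localized \<mu> p k"
proof -
  \<comment> \<open>The set \<open>E\<close> is left general: the whole space gives the row bound,
    the complement of a ball the tail.\<close>
  have est: "(\<integral>\<^sup>+y\<in>E. ennreal (k x y * p y) \<partial>\<mu>) \<le>
      ennreal a * (\<integral>\<^sup>+y\<in>E. ennreal (k1 x y * p y) \<partial>\<mu>) + ennreal b * (\<integral>\<^sup>+y\<in>E. ennreal (k2 x y * p y) \<partial>\<mu>)"
    if [measurable]: "E \<in> sets \<mu>" for x E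
  proof -
    have "ennreal (k x y * p y) * indicator E y \<le>
        ennreal a * (ennreal (k1 x y * p y) * indicator E y) +
        ennreal b * (ennreal (k2 x y * p y) * indicator E y)" for y
    proof -
      have "k x y * p y \<le> a * (k1 x y * p y) + b * (k2 x y * p y)"
        using mult_right_mono[OF le[of x y], of "p y"] p[of y] by (simp add: algebra_simps)
      then have "ennreal (k x y * p y) \<le> ennreal a * ennreal (k1 x y * p y) + ennreal b * ennreal (k2 x y * p y)"
        using p[of y] nn by (simp flip: ennreal_mult ennreal_plus add: ennreal_leI less_imp_le)
      then show ?thesis by (simp split: split_indicator)
    qed
    then have "(\<integral>\<^sup>+y\<in>E. ennreal (k x y * p y) \<partial>\<mu>) \<le> (\<integral>\<^sup>+y. ennreal a * (ennreal (k1 x y * p y) * indicator E y) +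
        ennreal b * (ennreal (k2 x y * p y) * indicator E y) \<partial>\<mu>)"
      by (intro nn_integral_mono)
    also have "\<dots> = ennreal a * (\<integral>\<^sup>+y\<in>E. ennreal (k1 x y * p y) \<partial>\<mu>) + ennreal b * (\<integral>\<^sup>+y\<in>E. ennreal (k2 x y * p y) \<partial>\<mu>)"
      by (simp add: nn_integral_add nn_integral_cmult)
    finally show ?thesis .
  qed
  obtain M where M: "M < top" "\<And>x. (\<integral>\<^sup>+y. ennreal (k1 x y * p y) \<partial>\<mu>) \<le> M * ennreal (p x)"
    using schur_localizedE[OF loc(1) p] by blast
  obtain N where N: "N < top" "\<And>x. (\<integral>\<^sup>+y. ennreal (k2 x y * p y) \<partial>\<mu>) \<le> N * ennreal (p x)"
    using schur_localizedE[OF loc(2) p] by blast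
  have sp: "space \<mu> = UNIV" using sets_eq_imp_space_eq[OF sets] by simp
  show ?thesis
  proof (rule schur_localizedI[OF loc p, of "ennreal a * M + ennreal b * N" "ennreal a" "ennreal b" 1])
    fix x
    have "(\<integral>\<^sup>+y. ennreal (k x y * p y) \<partial>\<mu>) \<le>
      ennreal a * (\<integral>\<^sup>+y. ennreal (k1 x y * p y) \<partial>\<mu>) + ennreal b * (\<integral>\<^sup>+y. ennreal (k2 x y * p y) \<partial>\<mu>)"
      using est[OF sets.top, of x] by (simp add: sp)
    also have "\<dots> \<le> ennreal a * (M * ennreal (p x)) + ennreal b * (N * ennreal (p x))"
      by (intro add_mono mult_left_mono M N) auto
    finally show "(\<integral>\<^sup>+y. ennreal (k x y * p y) \<partial>\<mu>) \<le> (ennreal a * M + ennreal b * N) * ennreal (p x)"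
      by (simp add: algebra_simps)
    fix R
    have "- cball x R \<in> sets \<mu>" using sets by simp
    note est[OF this, of x]
    also have "ennreal a * (\<integral>\<^sup>+y\<in>- cball x R. ennreal (k1 x y * p y) \<partial>\<mu>) + ennreal b * (\<integral>\<^sup>+y\<in>- cball x R. ennreal (k2 x y * p y) \<partial>\<mu>)
      \<le> ennreal a * (schur_tail \<mu> p k1 R * ennreal (p x)) + ennreal b * (schur_tail \<mu> p k2 R * ennreal (p x))"
      by (intro add_mono mult_left_mono schur_tail_bound p) auto
    finally show "(\<integral>\<^sup>+y\<in>- cball x R. ennreal (k x y * p y) \<partial>\<mu>)
      \<le> (ennreal a * schur_tail \<mu> p k1 (1 * R) + ennreal b * schur_tail \<mu> p k2 (1 * R)) * ennreal (p x)"
      by (simp add: algebra_simps)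
  qed (use M N in \<open>auto simp: ennreal_mult_less_top\<close>)
qed

text \<open>All integrals in the definition have integrands vanishing for \<open>y\<close> outside
  \<open>U\<close>, so only the measure on such integrands matters. This moves localization between
  \<open>\<mu>\<close> and its restriction to a sigma-compact set.\<close>

lemma schur_localized_measure_cong:
  assumes sets: "sets \<mu> = sets borel" and [measurable]: "p \<in> borel_measurable \<mu>"
    and [measurable]: "\<And>x. k x \<in> borel_measurable \<mu>"
    and eq: "\<And>F. F \<in> borel_measurable \<mu> \<Longrightarrow> (\<And>y. y \<notin> U \<Longrightarrow> F y = 0) \<Longrightarrow> (\<integral>\<^sup>+y. F y \<partial>\<mu>) = (\<integral>\<^sup>+y. F y \<partial>\<nu>)"
    and supp: "\<And>x y. y \<notin> U \<Longrightarrow> k x y = 0"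
  shows "schur_localized \<mu> p k \<longleftrightarrow> schur_localized \<nu> p k"
proof -
  have 1: "(\<integral>\<^sup>+y. ennreal (k x y * p y) \<partial>\<mu>) = (\<integral>\<^sup>+y. ennreal (k x y * p y) \<partial>\<nu>)" for x
    by (rule eq) (simp_all add: supp)
  have [measurable]: "- cball x R \<in> sets \<mu>" for x :: 'a and R
    using sets by simp
  have 2: "(\<integral>\<^sup>+y\<in>- cball x R. ennreal (k x y * p y) \<partial>\<mu>) = (\<integral>\<^sup>+y\<in>- cball x R. ennreal (k x y * p y) \<partial>\<nu>)" for x R
    by (rule eq) (simp_all add: supp)
  show ?thesis
    by (simp add: schur_localized_def schur_tail_def[abs_def] 1 2)
qed

section \<open>Composition of localized kernels\<close>

text \<open>The set \<open>{(z, y). dist z y > r}\<close> need not belong to the product of the Borel algebras of a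
  non-separable space; this countable union of rectangles is a measurable substitute.\<close>

definition far_pairs :: "'x::metric_space set \<Rightarrow> real \<Rightarrow> ('x \<times> 'x) set"
  where "far_pairs D r = (\<Union>a\<in>D. \<Union>q\<in>\<rat>. {z. dist z a < q} \<times> {y. dist y a > r + q})"

lemma far_pairs_measurable [measurable]:
  assumes "countable D" and sets: "sets \<nu> = sets borel"
  shows "far_pairs D r \<in> sets (\<nu> \<Otimes>\<^sub>M \<nu>)"
proof -
  have "{z. dist z a < q} \<in> sets \<nu>" "{y. dist y a > q} \<in> sets \<nu>" for a :: 'a and q :: real
    unfolding sets by (auto intro!: borel_open open_Collect_less continuous_intros)
  then show ?thesis
    unfolding far_pairs_def
    by (intro sets.countable_UN'[OF assms(1)] sets.countable_UN'[OF countable_rat] image_subsetI pair_measureI)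
qed

lemma far_pairs_imp_dist: "(z, y) \<in> far_pairs D r \<Longrightarrow> dist z y > r"
  unfolding far_pairs_def by (smt (verit) SigmaE UN_E dist_commute dist_triangle mem_Collect_eq prod.inject)

lemma dist_imp_far_pairs:
  assumes "dist z y > r" "z \<in> closure D"
  shows "(z, y) \<in> far_pairs D r"
proof -
  \<comment> \<open>A centre within \<open>q\<close> of \<open>z\<close> costs \<open>q\<close> in
    the triangle inequality and \<open>q\<close> in the definition of \<open>far_pairs\<close>,
    hence half of the gap.\<close>
  obtain q where q: "q \<in> \<rat>" "0 < q" "q < (dist z y - r) / 2"
    using Rats_dense_in_real[of 0 "(dist z y - r) / 2"] assms(1) by auto
  obtain a where a: "a \<in> D" "dist a z < q"
    using assms(2) q(2) by (auto simp: closure_approachable)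
  have "r + q < dist y a"
    using dist_triangle[of z y a] a q(3) by (simp add: dist_commute field_simps)
  with a q(1) show ?thesis
    by (auto simp: far_pairs_def dist_commute)
qed

text \<open>A Schur test: after Tonelli the two row bounds multiply. In the tail, a far
  \<open>z\<close> pairs the tail of \<open>k1\<close> with the row bound \<open>N\<close> of
  \<open>k2\<close>, while a near \<open>z\<close> leaves \<open>y\<close> far from \<open>z\<close>
  and pairs the tail of \<open>k2\<close> with the row bound \<open>M\<close> of
  \<open>k1\<close>.\<close>

lemma schur_localized_compose:
  fixes \<nu> :: "'x::metric_space measure"
  assumes sf: "sigma_finite_measure \<nu>" and sets: "sets \<nu> = sets borel"
    and D: "countable D" "AE z in \<nu>. z \<in> closure D"
    and loc: "schur_localized \<nu> p k1" "schur_localized \<nu> p k2" and p: "\<And>x. p x > 0"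
    and [measurable]: "p \<in> borel_measurable \<nu>" "\<And>x. k1 x \<in> borel_measurable \<nu>"
    and k2 [measurable]: "case_prod k2 \<in> borel_measurable (\<nu> \<Otimes>\<^sub>M \<nu>)"
    and nn: "\<And>x y. 0 \<le> k1 x y" "\<And>x y. 0 \<le> k2 x y"
    and le: "\<And>x y. ennreal (k x y) \<le> (\<integral>\<^sup>+z. ennreal (k1 x z * k2 z y) \<partial>\<nu>)"
  shows "schur_localized \<nu> p k"
proof -
  interpret sigma_finite_measure \<nu> by fact
  interpret P: pair_sigma_finite \<nu> \<nu> ..
  have sp: "space \<nu> = UNIV" using sets_eq_imp_space_eq[OF sets] by simp
  have k2m [measurable]: "k2 z \<in> borel_measurable \<nu>" for z
    using measurable_Pair2[OF k2, of z] by (simp add: sp)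
  have k2m' [measurable]: "(\<lambda>z. k2 z y) \<in> borel_measurable \<nu>" for y
    using measurable_Pair1[OF k2, of y] by (simp add: sp)
  \<comment> \<open>\<open>W\<close> is a majorant of the indicator of \<open>E\<close> that may
    depend on \<open>z\<close>: constantly 1 for the row bound, a sum of two indicators for the
    tail. It need only dominate for almost every \<open>z\<close>, since \<open>D\<close> is dense
    only in that sense.\<close>
  have est: "(\<integral>\<^sup>+y\<in>E. ennreal (k x y * p y) \<partial>\<nu>) \<le>
      (\<integral>\<^sup>+z. ennreal (k1 x z) * (\<integral>\<^sup>+y. ennreal (k2 z y * p y) * W z y \<partial>\<nu>) \<partial>\<nu>)"
    if [measurable]: "case_prod W \<in> borel_measurable (\<nu> \<Otimes>\<^sub>M \<nu>)" "E \<in> sets \<nu>"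
      and W: "AE z in \<nu>. \<forall>y. indicator E y \<le> W z y" for x E and W :: "'x \<Rightarrow> 'x \<Rightarrow> ennreal"
  proof -
    have [measurable]: "W z \<in> borel_measurable \<nu>" for z
      using measurable_Pair2[OF that(1), of z] by (simp add: sp)
    have "(\<integral>\<^sup>+y\<in>E. ennreal (k x y * p y) \<partial>\<nu>) \<le>
        (\<integral>\<^sup>+y. (\<integral>\<^sup>+z. ennreal (k1 x z * k2 z y) * (ennreal (p y) * indicator E y) \<partial>\<nu>) \<partial>\<nu>)"
      using p le by (intro nn_integral_mono)
        (auto simp: nn_integral_multc ennreal_mult'' less_imp_le mult.assoc intro!: mult_right_mono)
    also have "\<dots> \<le> (\<integral>\<^sup>+y. (\<integral>\<^sup>+z. ennreal (k1 x z) * (ennreal (k2 z y * p y) * W z y) \<partial>\<nu>) \<partial>\<nu>)"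
    proof (rule nn_integral_mono, rule nn_integral_mono_AE)
      fix y
      show "AE z in \<nu>. ennreal (k1 x z * k2 z y) * (ennreal (p y) * indicator E y)
          \<le> ennreal (k1 x z) * (ennreal (k2 z y * p y) * W z y)"
        using W
      proof eventually_elim
        case (elim z)
        have "ennreal (k1 x z * k2 z y) * (ennreal (p y) * indicator E y) =
            ennreal (k1 x z) * (ennreal (k2 z y * p y) * indicator E y)"
          using nn p[of y] by (simp add: ennreal_mult less_imp_le mult.assoc)
        also have "\<dots> \<le> ennreal (k1 x z) * (ennreal (k2 z y * p y) * W z y)"
          using elim by (intro mult_left_mono) auto
        finally show ?case .
      qed
    qed
    also have "\<dots> = (\<integral>\<^sup>+z. (\<integral>\<^sup>+y. ennreal (k1 x z) * (ennreal (k2 z y * p y) * W z y) \<partial>\<nu>) \<partial>\<nu>)"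
      by (rule P.Fubini') measurable
    also have "\<dots> = (\<integral>\<^sup>+z. ennreal (k1 x z) * (\<integral>\<^sup>+y. ennreal (k2 z y * p y) * W z y \<partial>\<nu>) \<partial>\<nu>)"
      by (intro nn_integral_cong nn_integral_cmult) measurable
    finally show ?thesis .
  qed
  obtain M where M: "M < top" "\<And>x. (\<integral>\<^sup>+y. ennreal (k1 x y * p y) \<partial>\<nu>) \<le> M * ennreal (p x)"
    using schur_localizedE[OF loc(1) p] by blast
  obtain N where N: "N < top" "\<And>x. (\<integral>\<^sup>+y. ennreal (k2 x y * p y) \<partial>\<nu>) \<le> N * ennreal (p x)"
    using schur_localizedE[OF loc(2) p] by blast
  have k1p: "ennreal (k1 x z) * (c * ennreal (p z)) = c * ennreal (k1 x z * p z)" for x z c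
    using nn p[of z] by (simp add: ennreal_mult less_imp_le ac_simps)
  show ?thesis
  proof (rule schur_localizedI[OF loc p, of "N * M" N M "1/2"])
    fix x
    have "(\<integral>\<^sup>+y. ennreal (k x y * p y) \<partial>\<nu>) \<le> (\<integral>\<^sup>+z. ennreal (k1 x z) * (\<integral>\<^sup>+y. ennreal (k2 z y * p y) * 1 \<partial>\<nu>) \<partial>\<nu>)"
      using est[of "\<lambda>_ _. 1", OF _ sets.top, of x] by (simp add: sp)
    also have "\<dots> \<le> (\<integral>\<^sup>+z. ennreal (k1 x z) * (N * ennreal (p z)) \<partial>\<nu>)"
      using N(2) by (intro nn_integral_mono mult_left_mono) auto
    also have "\<dots> = N * (\<integral>\<^sup>+z. ennreal (k1 x z * p z) \<partial>\<nu>)"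
      by (simp add: k1p nn_integral_cmult)
    also have "\<dots> \<le> N * (M * ennreal (p x))"
      by (intro mult_left_mono M) simp
    finally show "(\<integral>\<^sup>+y. ennreal (k x y * p y) \<partial>\<nu>) \<le> N * M * ennreal (p x)"
      by (simp add: mult.assoc)
    fix R :: real
    define r where "r = 1/2 * R"
    let ?B = "- cball x r" and ?t1 = "schur_tail \<nu> p k1 r" and ?t2 = "schur_tail \<nu> p k2 r"
    have [measurable]: "- cball x s \<in> sets \<nu>" for s using sets by simp
    \<comment> \<open>The summands stand for the two cases of the triangle inequality at radius
      \<open>R / 2\<close>; their overlap is harmless in an upper bound.\<close>
    define W :: "'x \<Rightarrow> 'x \<Rightarrow> ennreal"
      where "W z y = indicator ?B z + indicator (far_pairs D r) (z, y)" for z y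
    have far [measurable]: "far_pairs D r \<in> sets (\<nu> \<Otimes>\<^sub>M \<nu>)"
      by (rule far_pairs_measurable[OF D(1) sets])
    have "(\<integral>\<^sup>+y\<in>- cball x R. ennreal (k x y * p y) \<partial>\<nu>) \<le>
        (\<integral>\<^sup>+z. ennreal (k1 x z) * (\<integral>\<^sup>+y. ennreal (k2 z y * p y) * W z y \<partial>\<nu>) \<partial>\<nu>)"
    proof (rule est)
      show "case_prod W \<in> borel_measurable (\<nu> \<Otimes>\<^sub>M \<nu>)"
        unfolding W_def by measurable
      show "AE z in \<nu>. \<forall>y. indicator (- cball x R) y \<le> W z y"
        using D(2)
      proof eventually_elim
        case (elim z)
        have "z \<in> ?B \<or> (z, y) \<in> far_pairs D r" if "y \<in> - cball x R" for y
        proof (cases "z \<in> ?B")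
          case False
          then have "dist z y > r"
            using that dist_triangle[of x y z] by (simp add: r_def)
          then show ?thesis using dist_imp_far_pairs elim by blast
        qed simp
        then show ?case
          by (auto simp: W_def split: split_indicator)
      qed
    qed measurable
    also have "\<dots> \<le> (\<integral>\<^sup>+z. N * (ennreal (k1 x z * p z) * indicator ?B z) + ?t2 * ennreal (k1 x z * p z) \<partial>\<nu>)"
    proof (rule nn_integral_mono)
      fix z
      have [measurable]: "Pair z -` far_pairs D r \<in> sets \<nu>"
        using far by (rule sets_Pair1)
      have "(\<integral>\<^sup>+y. ennreal (k2 z y * p y) * W z y \<partial>\<nu>) =
          (\<integral>\<^sup>+y. ennreal (k2 z y * p y) * indicator ?B z +
            ennreal (k2 z y * p y) * indicator (Pair z -` far_pairs D r) y \<partial>\<nu>)"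
        by (simp add: W_def distrib_left indicator_def)
      also have "\<dots> = (\<integral>\<^sup>+y. ennreal (k2 z y * p y) \<partial>\<nu>) * indicator ?B z +
          (\<integral>\<^sup>+y\<in>Pair z -` far_pairs D r. ennreal (k2 z y * p y) \<partial>\<nu>)"
        by (simp add: nn_integral_add nn_integral_multc)
      also have "(\<integral>\<^sup>+y\<in>Pair z -` far_pairs D r. ennreal (k2 z y * p y) \<partial>\<nu>) \<le>
          (\<integral>\<^sup>+y\<in>- cball z r. ennreal (k2 z y * p y) \<partial>\<nu>)"
        using far_pairs_imp_dist[of z _ D r]
        by (intro nn_integral_mono mult_left_mono) (auto split: split_indicator simp: not_le)
      also have "\<dots> \<le> ?t2 * ennreal (p z)"
        by (rule schur_tail_bound) (rule p)
      also have "(\<integral>\<^sup>+y. ennreal (k2 z y * p y) \<partial>\<nu>) \<le> N * ennreal (p z)"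
        by (rule N)
      finally have "ennreal (k1 x z) * (\<integral>\<^sup>+y. ennreal (k2 z y * p y) * W z y \<partial>\<nu>) \<le>
          ennreal (k1 x z) * (N * ennreal (p z) * indicator ?B z + ?t2 * ennreal (p z))"
        by (auto intro!: mult_left_mono simp: add_mono mult_right_mono)
      also have "\<dots> = N * (ennreal (k1 x z * p z) * indicator ?B z) + ?t2 * ennreal (k1 x z * p z)"
        using k1p[of x z] by (simp add: distrib_left mult.assoc split: split_indicator)
      finally show "ennreal (k1 x z) * (\<integral>\<^sup>+y. ennreal (k2 z y * p y) * W z y \<partial>\<nu>) \<le>
          N * (ennreal (k1 x z * p z) * indicator ?B z) + ?t2 * ennreal (k1 x z * p z)" .
    qed
    also have "\<dots> = N * (\<integral>\<^sup>+z\<in>?B. ennreal (k1 x z * p z) \<partial>\<nu>) + ?t2 * (\<integral>\<^sup>+z. ennreal (k1 x z * p z) \<partial>\<nu>)"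
      by (simp add: nn_integral_add nn_integral_cmult)
    also have "\<dots> \<le> N * (?t1 * ennreal (p x)) + ?t2 * (M * ennreal (p x))"
      by (intro add_mono mult_left_mono schur_tail_bound M p) auto
    finally show "(\<integral>\<^sup>+y\<in>- cball x R. ennreal (k x y * p y) \<partial>\<nu>) \<le>
        (N * schur_tail \<nu> p k1 (1/2 * R) + M * schur_tail \<nu> p k2 (1/2 * R)) * ennreal (p x)"
      by (simp only: r_def algebra_simps)
  qed (use M N in \<open>auto simp: ennreal_mult_less_top\<close>)
qed

section \<open>Sigma-compact carriers and reduction to a sigma-finite measure\<close>

lemma radon_measure_open_sigma_compact:
  fixes \<mu> :: "'x::metric_space measure"
  assumes radon: "radon_measure \<mu>" and V: "open V" "emeasure \<mu> V < \<infinity>"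
  shows "\<exists>\<K>. countable \<K> \<and> (\<forall>K\<in>\<K>. compact K) \<and> (AE x in \<mu>. x \<in> V \<longrightarrow> x \<in> \<Union>\<K>)"
proof -
  have sets: "sets \<mu> = sets borel"
    and inner: "emeasure \<mu> V = (SUP K\<in>{K. compact K \<and> K \<subseteq> V}. emeasure \<mu> K)"
    using radon V by (auto simp: radon_measure_def)
  obtain g :: "nat \<Rightarrow> ennreal" where g: "range g \<subseteq> emeasure \<mu> ` {K. compact K \<and> K \<subseteq> V}"
    "emeasure \<mu> V = (SUP n. g n)"
    using ennreal_SUP_countable_SUP[of "{K. compact K \<and> K \<subseteq> V}" "emeasure \<mu>"] inner by auto
  have "\<exists>K. compact K \<and> K \<subseteq> V \<and> g n = emeasure \<mu> K" for n
    using g(1) by blast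
  then obtain K where K: "\<And>n. compact (K n)" "\<And>n. K n \<subseteq> V" "\<And>n. g n = emeasure \<mu> (K n)"
    by metis
  have [measurable]: "V \<in> sets \<mu>" "\<And>n. K n \<in> sets \<mu>"
    using V K(1) by (auto simp: sets compact_imp_closed)
  have "emeasure \<mu> V \<le> emeasure \<mu> (\<Union>n. K n)"
    unfolding g(2) K(3) by (intro SUP_least emeasure_mono) auto
  moreover have "emeasure \<mu> (\<Union>n. K n) \<le> emeasure \<mu> V"
    using K(2) by (intro emeasure_mono) auto
  ultimately have eq: "emeasure \<mu> (\<Union>n. K n) = emeasure \<mu> V" by simp
  \<comment> \<open>Inner regularity has given compact subsets whose union has the measure of
    \<open>V\<close>. As that measure is finite, subtraction leaves a null set.\<close>
  have "emeasure \<mu> (V - (\<Union>n. K n)) = emeasure \<mu> V - emeasure \<mu> (\<Union>n. K n)"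
    using K(2) V(2) eq by (intro emeasure_Diff) auto
  then have "emeasure \<mu> (V - (\<Union>n. K n)) = 0"
    using V(2) eq by simp
  then have "V - (\<Union>n. K n) \<in> null_sets \<mu>" by auto
  then have "AE x in \<mu>. x \<in> V \<longrightarrow> x \<in> \<Union>(range K)"
    by (rule AE_mp[OF AE_not_in]) auto
  then show ?thesis
    using K(1) by (intro exI[of _ "range K"]) auto
qed

text \<open>By total boundedness, the centres of finite covers by balls of radius
  \<open>1 / (n + 1)\<close>, taken over all \<open>n\<close>, approximate every point of
  \<open>K\<close>.\<close>

lemma compact_imp_separable:
  fixes K :: "'a::metric_space set"
  assumes "compact K"
  shows "\<exists>D. countable D \<and> K \<subseteq> closure D"
proof -
  have "\<exists>k. finite k \<and> K \<subseteq> (\<Union>x\<in>k. ball x (inverse (real (Suc n))))" for n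
    using assms unfolding compact_eq_totally_bounded by (metis inverse_positive_iff_positive of_nat_0_less_iff zero_less_Suc)
  then obtain k where k: "\<And>n. finite (k n)" "\<And>n. K \<subseteq> (\<Union>x\<in>k n. ball x (inverse (real (Suc n))))"
    by metis
  have "K \<subseteq> closure (\<Union>n. k n)"
  proof
    fix x assume x: "x \<in> K"
    show "x \<in> closure (\<Union>n. k n)"
      unfolding closure_approachable
    proof (intro allI impI)
      fix e :: real assume "e > 0"
      then obtain n where n: "inverse (real (Suc n)) < e" using reals_Archimedean by blast
      from k(2)[of n] x obtain y where y: "y \<in> k n" "x \<in> ball y (inverse (real (Suc n)))"
        by blast
      then have "dist y x < e" using n by (simp add: mem_ball)
      with y(1) show "\<exists>y\<in>\<Union>n. k n. dist y x < e" by blast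
    qed
  qed
  with k(1) show ?thesis by (intro exI[of _ "\<Union>n. k n"]) (auto intro: countable_finite)
qed

text \<open>The measure is not assumed sigma-finite, so Tonelli is applied to its restriction to a
  sigma-compact set that carries the support of the kernels.\<close>

lemma schur_localized_compose_sigma_compact:
  fixes \<mu> :: "'x::metric_space measure"
  assumes radon: "radon_measure \<mu>"
    and \<K>: "countable \<K>" "\<And>K. K \<in> \<K> \<Longrightarrow> compact K" "AE x in \<mu>. x \<in> U \<longrightarrow> x \<in> \<Union>\<K>"
    and supp: "\<And>x y. y \<notin> U \<Longrightarrow> k1 x y = 0" "\<And>x y. y \<notin> U \<Longrightarrow> k2 x y = 0" "\<And>x y. y \<notin> U \<Longrightarrow> k x y = 0"
    and loc: "schur_localized \<mu> p k1" "schur_localized \<mu> p k2" and p: "\<And>x. p x > 0"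
    and meas: "p \<in> borel_measurable \<mu>" "\<And>x. k1 x \<in> borel_measurable \<mu>" "\<And>x. k x \<in> borel_measurable \<mu>"
    and k2: "case_prod k2 \<in> borel_measurable (\<mu> \<Otimes>\<^sub>M \<mu>)"
    and nn: "\<And>x y. 0 \<le> k1 x y" "\<And>x y. 0 \<le> k2 x y"
    and le: "\<And>x y. ennreal (k x y) \<le> (\<integral>\<^sup>+z. ennreal (k1 x z * k2 z y) \<partial>\<mu>)"
  shows "schur_localized \<mu> p k"
proof -
  have sets: "sets \<mu> = sets borel" and fin: "\<And>K. compact K \<Longrightarrow> emeasure \<mu> K < \<infinity>"
    using radon by (auto simp: radon_measure_def)
  have sp: "space \<mu> = UNIV" using sets_eq_imp_space_eq[OF sets] by simp
  have K_sets: "K \<in> sets \<mu>" if "K \<in> \<K>" for K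
    using \<K>(2)[OF that] by (auto simp: sets compact_imp_closed)
  then have [measurable]: "\<Union>\<K> \<in> sets \<mu>"
    using \<K>(1) by (intro sets.countable_Union) auto
  \<comment> \<open>A density keeps the whole space and its Borel sets, so balls and measurability
    carry over unchanged.\<close>
  define \<nu> where "\<nu> = density \<mu> (indicator (\<Union>\<K>))"
  have sets_\<nu>: "sets \<nu> = sets \<mu>" and sp_\<nu>: "space \<nu> = UNIV" by (auto simp: \<nu>_def sp)
  have meas_\<nu>: "borel_measurable \<nu> = borel_measurable \<mu>"
    by (intro measurable_cong_sets sets_\<nu> refl)
  have eq: "(\<integral>\<^sup>+y. F y \<partial>\<mu>) = (\<integral>\<^sup>+y. F y \<partial>\<nu>)"
    if [measurable]: "F \<in> borel_measurable \<mu>" and F: "\<And>y. y \<notin> U \<Longrightarrow> F y = 0" for F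
  proof -
    have "(\<integral>\<^sup>+y. F y \<partial>\<nu>) = (\<integral>\<^sup>+y. indicator (\<Union>\<K>) y * F y \<partial>\<mu>)"
      unfolding \<nu>_def by (rule nn_integral_density) measurable
    also have "\<dots> = (\<integral>\<^sup>+y. F y \<partial>\<mu>)"
      using \<K>(3) F by (intro nn_integral_cong_AE) (auto split: split_indicator elim!: eventually_mono)
    finally show ?thesis by simp
  qed
  have localized_iff: "schur_localized \<mu> p j \<longleftrightarrow> schur_localized \<nu> p j"
    if "\<And>x. j x \<in> borel_measurable \<mu>" "\<And>x y. y \<notin> U \<Longrightarrow> j x y = 0" for j
  proof (rule schur_localized_measure_cong[where U = U, OF sets meas(1) that(1)])
    show "(\<integral>\<^sup>+y. F y \<partial>\<mu>) = (\<integral>\<^sup>+y. F y \<partial>\<nu>)"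
      if "F \<in> borel_measurable \<mu>" "\<And>y. y \<notin> U \<Longrightarrow> F y = 0" for F
      using that by (rule eq)
  qed (rule that(2))
  have sf: "sigma_finite_measure \<nu>"
  proof
    have em: "emeasure \<nu> A = emeasure \<mu> (\<Union>\<K> \<inter> A)" if [measurable]: "A \<in> sets \<mu>" for A
      using that unfolding \<nu>_def
      by (simp add: emeasure_density flip: indicator_inter_arith)
    have "emeasure \<nu> K \<noteq> \<infinity>" if "K \<in> \<K>" for K
    proof -
      have "emeasure \<nu> K \<le> emeasure \<mu> K"
        using K_sets[OF that] by (simp add: em emeasure_mono)
      then show ?thesis using fin[OF \<K>(2)[OF that]] by (auto simp: top_unique)
    qed
    \<comment> \<open>The complement of the carrier is null for \<open>\<nu>\<close>; added to the
      compact sets it completes a countable cover by sets of finite measure.\<close>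
    moreover have "emeasure \<nu> (- \<Union>\<K>) \<noteq> \<infinity>"
      using sets.compl_sets[of "\<Union>\<K>" \<mu>] by (simp add: em sp Compl_eq_Diff_UNIV)
    moreover have "- \<Union>\<K> \<in> sets \<nu>"
      using sets.compl_sets[of "\<Union>\<K>" \<mu>] by (simp add: sets_\<nu> sp Compl_eq_Diff_UNIV)
    ultimately show "\<exists>A. countable A \<and> A \<subseteq> sets \<nu> \<and> \<Union>A = space \<nu> \<and> (\<forall>a\<in>A. emeasure \<nu> a \<noteq> \<infinity>)"
      using \<K>(1) K_sets by (intro exI[of _ "insert (- \<Union>\<K>) \<K>"]) (auto simp: sets_\<nu> sp_\<nu>)
  qed
  obtain D where D: "\<And>K. K \<in> \<K> \<Longrightarrow> countable (D K) \<and> K \<subseteq> closure (D K)"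
    using compact_imp_separable \<K>(2) by metis
  have dense: "AE z in \<nu>. z \<in> closure (\<Union>K\<in>\<K>. D K)"
    unfolding \<nu>_def
  proof (subst AE_density)
    have "z \<in> closure (\<Union>K\<in>\<K>. D K)" if "z \<in> K" "K \<in> \<K>" for z K
      using D[OF that(2)] that closure_mono[of "D K" "\<Union>K\<in>\<K>. D K"] by blast
    then show "AE z in \<mu>. 0 < (indicator (\<Union>\<K>) z :: ennreal) \<longrightarrow> z \<in> closure (\<Union>K\<in>\<K>. D K)"
      by (intro AE_I2) (auto simp: indicator_def)
  qed measurable
  have loc1: "schur_localized \<nu> p k1"
    using loc(1) localized_iff[OF meas(2) supp(1)] by simp
  have loc2: "schur_localized \<nu> p k2"
  proof -
    have "k2 x \<in> borel_measurable \<mu>" for x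
      using measurable_Pair2[OF k2, of x] by (simp add: sp)
    from localized_iff[OF this supp(2)] show ?thesis using loc(2) by simp
  qed
  have le': "ennreal (k x y) \<le> (\<integral>\<^sup>+z. ennreal (k1 x z * k2 z y) \<partial>\<nu>)" for x y
  proof -
    have [measurable]: "(\<lambda>z. k2 z y) \<in> borel_measurable \<mu>"
      using measurable_Pair1[OF k2, of y] by (simp add: sp)
    note [measurable] = meas
    have "(\<integral>\<^sup>+z. ennreal (k1 x z * k2 z y) \<partial>\<mu>) = (\<integral>\<^sup>+z. ennreal (k1 x z * k2 z y) \<partial>\<nu>)"
      by (rule eq) (simp_all add: supp)
    with le[of x y] show ?thesis by simp
  qed
  have k2': "case_prod k2 \<in> borel_measurable (\<nu> \<Otimes>\<^sub>M \<nu>)"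
    using k2 measurable_cong_sets[OF sets_pair_measure_cong[OF sets_\<nu> sets_\<nu>] refl] by blast
  have "countable (\<Union>K\<in>\<K>. D K)"
    using \<K>(1) D by blast
  then have "schur_localized \<nu> p k"
    by (rule schur_localized_compose[OF sf sets_\<nu>[unfolded sets] _ dense loc1 loc2 p
          meas(1)[folded meas_\<nu>] meas(2)[folded meas_\<nu>] k2' nn le'])
  then show ?thesis
    using localized_iff[of k] meas(3) supp(3) by simp
qed

section \<open>Weakly localized operators\<close>

text \<open>The support of \<open>f\<close> is covered by the countably many sets
  \<open>V h n\<close> with \<open>h\<close> in the dense set. Each is open of finite measure, hence
  sigma-compact up to a null set, and countably many null sets may be discarded.\<close>

lemma (in bounded_frame) frame_support_sigma_compact:
  assumes radon: "radon_measure \<mu>"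
    and "countable Q" and dense: "\<And>V. open V \<Longrightarrow> V \<noteq> {} \<Longrightarrow> \<exists>h\<in>Q. h \<in> (V::'h set)"
  shows "\<exists>\<K>. countable \<K> \<and> (\<forall>K\<in>\<K>. compact K) \<and> (AE x in \<mu>. f x \<noteq> 0 \<longrightarrow> x \<in> \<Union>\<K>)"
proof -
  define V where "V h n = {x. inverse (real (Suc n)) < cmod (cinner h (f x))}" for h n
  have V_open: "open (V h n)" for h n
    unfolding V_def
    by (intro open_Collect_less continuous_intros continuous_frame
        bounded_bilinear.continuous_on[OF bounded_bilinear_cinner])
  have V_fin: "emeasure \<mu> (V h n) < \<infinity>" for h n
  proof -
    have [measurable]: "V h n \<in> sets \<mu>" using V_open by (simp add: sets_eq)
    \<comment> \<open>Chebyshev's inequality: the scaled square dominates the indicator, and its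
      integral is finite by the upper frame bound.\<close>
    have "1 \<le> (real (Suc n))\<^sup>2 * (cmod (cinner h (f x)))\<^sup>2" if "x \<in> V h n" for x
    proof -
      have "1 \<le> real (Suc n) * cmod (cinner h (f x))"
        using that by (simp add: V_def field_simps)
      then show ?thesis
        unfolding power_mult_distrib[symmetric] by (rule one_le_power)
    qed
    then have "indicator (V h n) x \<le> ennreal ((real (Suc n))\<^sup>2 * (cmod (cinner h (f x)))\<^sup>2)" for x
      by (auto split: split_indicator simp flip: ennreal_1 intro!: ennreal_leI)
    then have "(\<integral>\<^sup>+x. indicator (V h n) x \<partial>\<mu>) \<le> (\<integral>\<^sup>+x. ennreal ((real (Suc n))\<^sup>2 * (cmod (cinner h (f x)))\<^sup>2) \<partial>\<mu>)"
      by (rule nn_integral_mono)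
    also have "\<dots> = ennreal (\<integral>x. (real (Suc n))\<^sup>2 * (cmod (cinner h (f x)))\<^sup>2 \<partial>\<mu>)"
      using integrable_frame_square[of h] by (intro nn_integral_eq_integral integrable_mult_right) auto
    finally show ?thesis by (auto simp: top_unique less_top[symmetric])
  qed
  have "\<exists>\<K>. countable \<K> \<and> (\<forall>K\<in>\<K>. compact K) \<and> (AE x in \<mu>. x \<in> V h n \<longrightarrow> x \<in> \<Union>\<K>)" for h n
    by (rule radon_measure_open_sigma_compact[OF radon V_open V_fin])
  then obtain \<K> where \<K>: "\<And>h n. countable (\<K> h n)" "\<And>h n K. K \<in> \<K> h n \<Longrightarrow> compact K"
    "\<And>h n. AE x in \<mu>. x \<in> V h n \<longrightarrow> x \<in> \<Union>(\<K> h n)"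
    by metis
  have covered: "AE x in \<mu>. \<forall>h\<in>Q. \<forall>n. x \<in> V h n \<longrightarrow> x \<in> \<Union>(\<K> h n)"
    using \<K>(3) by (simp add: AE_ball_countable[OF \<open>countable Q\<close>] AE_all_countable)
  have support: "\<exists>h\<in>Q. \<exists>n. x \<in> V h n" if "f x \<noteq> 0" for x
  proof -
    \<comment> \<open>The vectors not orthogonal to \<open>f x\<close> form an open set containing
      \<open>f x\<close> itself, so the dense set meets it.\<close>
    have "open {h. cinner h (f x) \<noteq> 0}"
      by (intro open_Collect_neq continuous_intros
          bounded_bilinear.continuous_on[OF bounded_bilinear_cinner])
    moreover have "f x \<in> {h. cinner h (f x) \<noteq> 0}"
      using that by (simp add: cinner_self)
    ultimately obtain h where "h \<in> Q" "cinner h (f x) \<noteq> 0"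
      using dense by blast
    then show ?thesis
      using reals_Archimedean[of "cmod (cinner h (f x))"] by (auto simp: V_def)
  qed
  have "AE x in \<mu>. f x \<noteq> 0 \<longrightarrow> x \<in> \<Union>(\<Union>h\<in>Q. \<Union>n. \<K> h n)"
    using covered
  proof eventually_elim
    case (elim x)
    show ?case
    proof
      assume "f x \<noteq> 0"
      then obtain h n where h: "h \<in> Q" "x \<in> V h n" using support by blast
      with elim have "x \<in> \<Union>(\<K> h n)" by blast
      with h(1) show "x \<in> \<Union>(\<Union>h\<in>Q. \<Union>n. \<K> h n)" by blast
    qed
  qed
  then show ?thesis
    using \<K>(1,2) \<open>countable Q\<close> by (intro exI[of _ "\<Union>h\<in>Q. \<Union>n. \<K> h n"]) auto
qed

text \<open>Separability of the Hilbert space is expressed as second countability, which is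
  equivalent for metric spaces.\<close>

locale radon_frame = bounded_frame \<mu> f c C
  for \<mu> :: "'x::metric_space measure"
    and f :: "'x \<Rightarrow> 'h::{complex_hilbert_space, second_countable_topology}" and c C :: real +
  fixes p :: "'x \<Rightarrow> real"
  assumes radon: "radon_measure \<mu>"
    and p_measurable: "p \<in> borel_measurable \<mu>"
    and p_pos: "p x > 0"
begin

section \<open>Operator kernels and the algebra of localized operators\<close>

definition frame_kernel :: "('h \<Rightarrow> 'h) \<Rightarrow> 'x \<Rightarrow> 'x \<Rightarrow> real"
  where "frame_kernel T x y = cmod (cinner (T (canonical_dual \<mu> f x)) (f y))"

lemma mem_weakly_localized_operators_iff:
  "T \<in> weakly_localized_operators \<mu> p f \<longleftrightarrow> bounded_clinear T \<and>
    schur_localized \<mu> p (frame_kernel T) \<and> schur_localized \<mu> p (\<lambda>y x. frame_kernel T x y)"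
  by (simp add: weakly_localized_operators_def weakly_localized_pair_iff[OF p_pos] frame_kernel_def[abs_def])

lemma weakly_localized_linear:
  assumes "T \<in> weakly_localized_operators \<mu> p f"
  shows "T (g + h) = T g + T h" "T (a *\<^sub>C h) = a *\<^sub>C T h"
  using assms by (simp_all add: mem_weakly_localized_operators_iff bounded_clinear_simps)

lemma space_eq: "space \<mu> = UNIV"
  using sets_eq_imp_space_eq[OF sets_eq] by simp

text \<open>Tonelli needs measurability for the product of the Borel algebras, which may be smaller
  than the Borel algebra of the product. Second countability of the Hilbert space lets the
  continuous inner product be composed with two measurable maps. Both orders are needed, for rows
  and for columns.\<close>

lemma frame_kernel_measurable_pair:
  assumes "bounded_clinear T"
  shows "(\<lambda>(x, y). frame_kernel T x y) \<in> borel_measurable (\<mu> \<Otimes>\<^sub>M \<mu>)"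
    and "(\<lambda>(y, x). frame_kernel T x y) \<in> borel_measurable (\<mu> \<Otimes>\<^sub>M \<mu>)"
proof -
  have [measurable]: "f \<in> borel_measurable \<mu>"
    by (intro continuous_imp_measurable continuous_frame)
  have "continuous_on UNIV (\<lambda>x. T (canonical_dual \<mu> f x))"
    using assms unfolding canonical_dual_def bounded_clinear_def
    by (intro bounded_linear.continuous_on[of T] bounded_linear.continuous_on[OF bounded_linear_inv_frame_operator]
        continuous_frame) simp
  then have [measurable]: "(\<lambda>x. T (canonical_dual \<mu> f x)) \<in> borel_measurable \<mu>"
    by (rule continuous_imp_measurable)
  have cont: "continuous_on UNIV (\<lambda>z::'h \<times> 'h. cmod (cinner (fst z) (snd z)))"
    by (intro continuous_intros bounded_bilinear.continuous_on[OF bounded_bilinear_cinner])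
  show "(\<lambda>(x, y). frame_kernel T x y) \<in> borel_measurable (\<mu> \<Otimes>\<^sub>M \<mu>)"
    unfolding frame_kernel_def case_prod_beta
    by (rule borel_measurable_continuous_Pair[where H = "\<lambda>x y. cmod (cinner x y)", OF _ _ cont]) measurable
  show "(\<lambda>(y, x). frame_kernel T x y) \<in> borel_measurable (\<mu> \<Otimes>\<^sub>M \<mu>)"
    unfolding frame_kernel_def case_prod_beta
    by (rule borel_measurable_continuous_Pair[where H = "\<lambda>x y. cmod (cinner x y)", OF _ _ cont]) measurable
qed

lemma frame_kernel_measurable:
  assumes "bounded_clinear T"
  shows "frame_kernel T x \<in> borel_measurable \<mu>" and "(\<lambda>x. frame_kernel T x y) \<in> borel_measurable \<mu>"
  using measurable_Pair2[OF frame_kernel_measurable_pair(1)[OF assms], of x]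
    measurable_Pair2[OF frame_kernel_measurable_pair(2)[OF assms], of y] by (simp_all add: space_eq)

lemma frame_kernel_nonneg: "0 \<le> frame_kernel T x y"
  by (simp add: frame_kernel_def)

lemma frame_kernel_eq_0:
  assumes "bounded_clinear T"
  shows "f x = 0 \<Longrightarrow> frame_kernel T x y = 0" "f y = 0 \<Longrightarrow> frame_kernel T x y = 0"
  using assms by (auto simp: frame_kernel_def canonical_dual_eq_0 bounded_clinear_simps)

lemma weakly_localized_combination:
  assumes "S \<in> weakly_localized_operators \<mu> p f" "T \<in> weakly_localized_operators \<mu> p f"
    and "bounded_clinear V" and "0 \<le> a" "0 \<le> b"
    and "\<And>x y. frame_kernel V x y \<le> a * frame_kernel S x y + b * frame_kernel T x y"
  shows "V \<in> weakly_localized_operators \<mu> p f"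
proof -
  have S: "bounded_clinear S" "schur_localized \<mu> p (frame_kernel S)" "schur_localized \<mu> p (\<lambda>y x. frame_kernel S x y)"
    and T: "bounded_clinear T" "schur_localized \<mu> p (frame_kernel T)" "schur_localized \<mu> p (\<lambda>y x. frame_kernel T x y)"
    using assms by (auto simp: mem_weakly_localized_operators_iff)
  have "schur_localized \<mu> p (frame_kernel V)"
    by (rule schur_localized_combination[OF S(2) T(2) p_pos sets_eq p_measurable frame_kernel_measurable(1)[OF S(1)]
        frame_kernel_measurable(1)[OF T(1)] frame_kernel_nonneg frame_kernel_nonneg assms(4-6)])
  moreover have "schur_localized \<mu> p (\<lambda>y x. frame_kernel V x y)"
    by (rule schur_localized_combination[OF S(3) T(3) p_pos sets_eq p_measurable frame_kernel_measurable(2)[OF S(1)]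
        frame_kernel_measurable(2)[OF T(1)] frame_kernel_nonneg frame_kernel_nonneg assms(4-6)])
  ultimately show ?thesis
    using assms(3) by (simp add: mem_weakly_localized_operators_iff)
qed

lemma weakly_localized_zero: "(\<lambda>h. 0) \<in> weakly_localized_operators \<mu> p f"
  by (simp add: mem_weakly_localized_operators_iff bounded_clinear_zero frame_kernel_def[abs_def] schur_localized_zero)

lemma weakly_localized_add:
  assumes "S \<in> weakly_localized_operators \<mu> p f" "T \<in> weakly_localized_operators \<mu> p f"
  shows "(\<lambda>h. S h + T h) \<in> weakly_localized_operators \<mu> p f"
proof (rule weakly_localized_combination[OF assms, of _ 1 1])
  show "bounded_clinear (\<lambda>h. S h + T h)"
    using assms by (simp add: mem_weakly_localized_operators_iff bounded_clinear_add)
qed (simp_all add: frame_kernel_def cinner_add_left norm_triangle_ineq)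

lemma weakly_localized_scaleC:
  assumes "T \<in> weakly_localized_operators \<mu> p f"
  shows "(\<lambda>h. a *\<^sub>C T h) \<in> weakly_localized_operators \<mu> p f"
proof (rule weakly_localized_combination[OF assms assms, of _ "cmod a" 0])
  show "bounded_clinear (\<lambda>h. a *\<^sub>C T h)"
    using assms by (simp add: mem_weakly_localized_operators_iff bounded_clinear_scaleC)
qed (simp_all add: frame_kernel_def cinner_scaleC_left norm_mult)

lemma weakly_localized_compose:
  assumes "S \<in> weakly_localized_operators \<mu> p f" "T \<in> weakly_localized_operators \<mu> p f"
  shows "S \<circ> T \<in> weakly_localized_operators \<mu> p f"
proof -
  have S: "bounded_clinear S" "schur_localized \<mu> p (frame_kernel S)" "schur_localized \<mu> p (\<lambda>y x. frame_kernel S x y)"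
    and T: "bounded_clinear T" "schur_localized \<mu> p (frame_kernel T)" "schur_localized \<mu> p (\<lambda>y x. frame_kernel T x y)"
    using assms by (auto simp: mem_weakly_localized_operators_iff)
  have ST: "bounded_clinear (S \<circ> T)"
    by (rule bounded_clinear_compose[OF S(1) T(1)])
  obtain Q :: "'h set" where "countable Q" "\<And>V. open V \<Longrightarrow> V \<noteq> {} \<Longrightarrow> \<exists>h\<in>Q. h \<in> V"
    using countable_dense_setE by blast
  then obtain \<K> where \<K>: "countable \<K>" "\<And>K. K \<in> \<K> \<Longrightarrow> compact K"
    "AE x in \<mu>. f x \<noteq> 0 \<longrightarrow> x \<in> \<Union>\<K>"
    using frame_support_sigma_compact[OF radon] by metis
  then have \<K>': "AE x in \<mu>. x \<in> {x. f x \<noteq> 0} \<longrightarrow> x \<in> \<Union>\<K>" by simp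
  have le: "ennreal (frame_kernel (S \<circ> T) x y) \<le> (\<integral>\<^sup>+z. ennreal (frame_kernel T x z * frame_kernel S z y) \<partial>\<mu>)" for x y
    unfolding frame_kernel_def o_def by (rule norm_cinner_le_kernel_composition[OF S(1)])
  have "schur_localized \<mu> p (frame_kernel (S \<circ> T))"
    by (rule schur_localized_compose_sigma_compact[OF radon \<K>(1,2) \<K>' _ _ _ T(2) S(2) p_pos
          p_measurable frame_kernel_measurable(1)[OF T(1)] frame_kernel_measurable(1)[OF ST]
          frame_kernel_measurable_pair(1)[OF S(1)] frame_kernel_nonneg frame_kernel_nonneg le])
       (simp_all add: frame_kernel_eq_0 S(1) T(1) ST)
  \<comment> \<open>Transposition reverses the factors: the first kernel now comes from
    \<open>S\<close> and the second, jointly measurable one from \<open>T\<close>.\<close>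
  moreover have "schur_localized \<mu> p (\<lambda>y x. frame_kernel (S \<circ> T) x y)"
    by (rule schur_localized_compose_sigma_compact[OF radon \<K>(1,2) \<K>' _ _ _ S(3) T(3) p_pos
          p_measurable frame_kernel_measurable(2)[OF S(1)] frame_kernel_measurable(2)[OF ST]
          frame_kernel_measurable_pair(2)[OF T(1)] frame_kernel_nonneg frame_kernel_nonneg])
       (use le in \<open>simp_all add: frame_kernel_eq_0 S(1) T(1) ST mult.commute\<close>)
  ultimately show ?thesis
    using ST by (simp add: mem_weakly_localized_operators_iff)
qed

lemma complex_algebra_weakly_localized:
  "complex_algebra_on (weakly_localized_operators \<mu> p f)
    (\<lambda>S T h. S h + T h) (\<lambda>h. 0) (\<lambda>c T h. c *\<^sub>C T h) (\<circ>)"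
proof
  fix S assume S: "S \<in> weakly_localized_operators \<mu> p f"
  have "S h + (-1) *\<^sub>C S h = 0" for h
    using scaleC_add_left[of 1 "-1" "S h"] by simp
  then show "\<exists>T\<in>weakly_localized_operators \<mu> p f. (\<lambda>h. S h + T h) = (\<lambda>h. 0)"
    by (intro bexI[OF _ weakly_localized_scaleC[OF S, of "-1"]]) simp
qed (simp_all add: weakly_localized_zero weakly_localized_add weakly_localized_scaleC
    weakly_localized_compose weakly_localized_linear scaleC_add_right scaleC_add_left scaleC_scaleC
    fun_eq_iff ac_simps)

end

text \<open>Since the dual frame is the frame itself, the kernel of the adjoint is the transposed
  kernel, and transposition merely swaps the row and column conditions. The other star laws follow
  from uniqueness of adjoints.\<close>

lemma parseval_star_algebra_weakly_localized:
  assumes "radon_frame \<mu> f 1 1 p"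
  shows "complex_star_algebra_on (weakly_localized_operators \<mu> p f)
    (\<lambda>S T h. S h + T h) (\<lambda>h. 0) (\<lambda>c T h. c *\<^sub>C T h) (\<circ>) cadjoint"
proof -
  interpret radon_frame \<mu> f 1 1 p by fact
  have dual: "canonical_dual \<mu> f = f"
    using frame_operator_parseval[OF bounded_frame_axioms] by (simp add: canonical_dual_def[abs_def])
  have star: "cadjoint S \<in> weakly_localized_operators \<mu> p f"
      "cadjoint (cadjoint S) = S"
      "cadjoint (\<lambda>h. s *\<^sub>C S h) = (\<lambda>h. cnj s *\<^sub>C cadjoint S h)"
    if S: "S \<in> weakly_localized_operators \<mu> p f" for S s
  proof -
    have bc: "bounded_clinear S" using S by (simp add: mem_weakly_localized_operators_iff)
    have "frame_kernel (cadjoint S) = (\<lambda>y x. frame_kernel S x y)"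
      using bc by (simp add: frame_kernel_def fun_eq_iff dual cinner_cadjoint_left norm_cinner_commute)
    with S show "cadjoint S \<in> weakly_localized_operators \<mu> p f"
      by (simp add: mem_weakly_localized_operators_iff bounded_clinear_cadjoint)
    show "cadjoint (cadjoint S) = S"
      using bc by (intro cadjoint_eqI) (simp add: cinner_cadjoint_left)
    show "cadjoint (\<lambda>h. s *\<^sub>C S h) = (\<lambda>h. cnj s *\<^sub>C cadjoint S h)"
      using bc by (intro cadjoint_eqI) (simp add: cinner_scaleC_left cinner_scaleC_right cinner_cadjoint_right)
  qed
  have star2: "cadjoint (\<lambda>h. S h + T h) = (\<lambda>h. cadjoint S h + cadjoint T h)"
      "cadjoint (S \<circ> T) = cadjoint T \<circ> cadjoint S"
    if "S \<in> weakly_localized_operators \<mu> p f" "T \<in> weakly_localized_operators \<mu> p f" for S T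
  proof -
    have bc: "bounded_clinear S" "bounded_clinear T"
      using that by (simp_all add: mem_weakly_localized_operators_iff)
    show "cadjoint (\<lambda>h. S h + T h) = (\<lambda>h. cadjoint S h + cadjoint T h)"
      using bc by (intro cadjoint_eqI) (simp add: cinner_add_left cinner_add_right cinner_cadjoint_right)
    show "cadjoint (S \<circ> T) = cadjoint T \<circ> cadjoint S"
      using bc by (intro cadjoint_eqI) (simp add: cinner_cadjoint_right)
  qed
  show ?thesis
    by (intro complex_star_algebra_on.intro complex_star_algebra_on_axioms.intro
        complex_algebra_weakly_localized star star2)
qed

theorem proposition2p2:
  fixes \<mu> :: "'x::metric_space measure"
    and p :: "'x \<Rightarrow> real"
    and f :: "'x \<Rightarrow> 'h::{complex_hilbert_space, second_countable_topology}"
  assumes "locally_compact_space (euclidean :: 'x topology)"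
    and "radon_measure \<mu>"
    and "p \<in> borel_measurable \<mu>"
    and "\<And>x. p x > 0"
    and "weakly_localized_frame \<mu> p f"
  shows "complex_algebra_on (weakly_localized_operators \<mu> p f)
           (\<lambda>S T h. S h + T h) (\<lambda>h. 0) (\<lambda>c T h. c *\<^sub>C T h) (\<circ>) \<and>
         (parseval_frame \<mu> f \<longrightarrow>
         complex_star_algebra_on (weakly_localized_operators \<mu> p f)
           (\<lambda>S T h. S h + T h) (\<lambda>h. 0) (\<lambda>c T h. c *\<^sub>C T h) (\<circ>) cadjoint)"
proof -
  \<comment> \<open>The set of localized operators does not involve the frame bounds, so the given
    bounds serve for the algebra and the bounds 1 for the Parseval case.\<close>
  have radon_frame: "radon_frame \<mu> f c C p"
    if "c > 0" "C > 0" "continuous_frame_with_bounds \<mu> c C f" for c C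
    using assms that by unfold_locales (auto simp: radon_measure_def)
  obtain c C where "c > 0" "C > 0" "continuous_frame_with_bounds \<mu> c C f"
    using assms(5) by (auto simp: weakly_localized_frame_def continuous_frame_def)
  then have "radon_frame \<mu> f c C p" by (rule radon_frame)
  moreover have "radon_frame \<mu> f 1 1 p" if "parseval_frame \<mu> f"
    using that by (intro radon_frame) (auto simp: parseval_frame_def)
  ultimately show ?thesis
    by (blast intro: radon_frame.complex_algebra_weakly_localized
        parseval_star_algebra_weakly_localized)
qed

end
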